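(* Let $K\ge 2$ be a fixed integer and let $\{A_n\}_{n\ge 0}$ be the annihilation-creation process on $\mathbf{Z}$ with parameter $K$ started from $A_0=\{0\}$ (defined in the context). Then with probability $1$: 1) $G^{(2)}(A_n)=1$ for infinitely many $n$; 2) $G^{(2)}(A_n)=0$ for infinitely many $n$; 3) $L(A_n)\le G(A_n)+1$ for all sufficiently large $n$.
   Context: Annihilation-creation process with integer parameter $K\ge 2$: a Markov chain $\{A_n\}_{n\ge0}$ of finite nonempty subsets of $\mathbf{Z}$ (occupied sites). Given $A_n$, the set $A_{n+1}$ is constructed by first adding $K$ sites one by one and then deleting $K-1$ sites one by one. In each addition step, the new site is chosen uniformly from the boundary of the current set of occupied sites, where the boundary of $a\subset\mathbf{Z}$ is $\partial a=\{y\in\mathbf{Z}\setminus a:\ \exists x\in a,\ |x-y|=1\}$. In each deletion step, the site to be removed is chosen uniformly from the current set of occupied sites. Thus $|A_{n+1}|=|A_n|+1$. A gap of $a\subset\mathbf{Z}$ is a nonempty subset $g$ of $\mathbf{Z}\setminus a$ such that there exist $x_1,x_2\in a$ with $g=\{y\in\mathbf{Z}: x_1<y<x_2\}$. For finite $a$: $G(a)$ is the number of gaps of $a$; $G^{(2)}(a)$ is the number of gaps $g$ of $a$ with $|g|\ge 2$; $L(a)$ is the number of unoccupied sites between the endpoints $\min a$ and $\max a$ of $a$, i.e. the sum of the sizes of all gaps of $a$. *)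

theory Defs
  imports "HOL-Probability.Probability"
begin

definition site_boundary :: "int set \<Rightarrow> int set" where
  "site_boundary a = {y. y \<notin> a \<and> (\<exists>x\<in>a. \<bar>x - y\<bar> = 1)}"

text \<open>
  \<^const>\<open>pmf_of_set\<close> is meaningful only for finite nonempty sets. This is always the case
  below when the chain is at a finite nonempty set: the boundary of such a set is finite and
  nonempty, and \<open>K - 1\<close> deletions after \<open>K\<close> additions never exhaust the set.
\<close>

definition add_site :: "int set \<Rightarrow> int set pmf" where
  "add_site a = map_pmf (\<lambda>y. insert y a) (pmf_of_set (site_boundary a))"

definition delete_site :: "int set \<Rightarrow> int set pmf" where
  "delete_site a = map_pmf (\<lambda>x. a - {x}) (pmf_of_set a)"

definition ac_transition :: "nat \<Rightarrow> int set \<Rightarrow> int set pmf" where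
  "ac_transition K a =
     ((\<lambda>p. bind_pmf p delete_site) ^^ (K - 1)) (((\<lambda>p. bind_pmf p add_site) ^^ K) (return_pmf a))"

text \<open>
  A Markov chain on the countable space of finite nonempty subsets of the integers with transition
  law \<^const>\<open>ac_transition\<close>, on an arbitrary probability space; the initial law is left open.
\<close>

locale annihilation_creation_process = prob_space M
  for M :: "'w measure" +
  fixes K :: nat and A :: "nat \<Rightarrow> 'w \<Rightarrow> int set"
  assumes measurable_A: "\<And>n. A n \<in> measurable M (count_space {a. finite a \<and> a \<noteq> {}})"
    and markov: "\<And>n a b. \<P>(\<omega> in M. \<forall>i\<le>n. A i \<omega> = a i) > 0 \<Longrightarrow>
      \<P>(\<omega> in M. A (Suc n) \<omega> = b \<bar> \<forall>i\<le>n. A i \<omega> = a i) = pmf (ac_transition K (a n)) b"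

definition gaps :: "int set \<Rightarrow> int set set" where
  "gaps a = {g. g \<noteq> {} \<and> g \<subseteq> - a \<and> (\<exists>x1\<in>a. \<exists>x2\<in>a. g = {x1<..<x2})}"

definition num_gaps :: "int set \<Rightarrow> nat" where
  "num_gaps a = card (gaps a)"

definition num_gaps2 :: "int set \<Rightarrow> nat" where
  "num_gaps2 a = card {g \<in> gaps a. card g \<ge> 2}"

definition num_unoccupied :: "int set \<Rightarrow> nat" where
  "num_unoccupied a = card ({Min a<..<Max a} - a)"

end

theory Submission imports Defs begin

text \<open>
  Call the unoccupied sites between the endpoints of a configuration its \<^emph>\<open>holes\<close>, and let the
  \<^emph>\<open>excess\<close> be the number of holes whose right neighbour is a hole as well. Every gap contributes
  its size minus one to the excess, so \<open>L = G + excess\<close>, and a gap of size at least two exists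
  exactly when the excess is positive. The theorem therefore says that almost surely the excess
  is positive infinitely often, vanishes infinitely often, and is eventually at most one.

  Heuristically, a deletion in the interior of a long run of occupied sites makes a new gap of
  size one, and an addition fills a uniformly chosen boundary site. Since \<open>K\<close> additions compete
  with \<open>K - 1\<close> deletions, the number of holes stays bounded in probability although the
  configuration grows: \<open>n + 1\<close> sites are occupied at time \<open>n\<close>. The excess can only grow when a
  deletion hits a site near a hole, which has probability of order \<open>1 / n\<close>, and an existing
  excess is removed at a rate bounded below. So it is positive with probability of order
  \<open>1 / n\<close>: not summable, hence infinitely often, but rarely enough to vanish infinitely often.
  Excess at least two needs two such accidents close in time, which has probability of order
  \<open>1 / n\<^sup>2\<close>, and this is summable.

  One deletion can raise the excess by two: if the only occupied site between two gaps
  disappears, the gaps merge. Such a site is the result of an earlier accident, and must be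
  counted as one. This is the reason for the quantity \<^emph>\<open>crowding\<close>, which is positive as soon as two
  holes are at distance at most two. From crowding zero a single deletion produces excess at
  most one.

  The quantitative core is \<open>lyapunov_drift\<close>: the function
  \<open>M * r ^ crowding + r ^ (2 * number of holes)\<close> contracts by a constant factor in one step of
  the chain from a large configuration, up to an additive constant that appears only at crowding zero. With \<open>r = 4\<close> this
  bounds an exponential moment of the number of holes (\<open>holes_moment_bounded\<close>). With \<open>r = 2\<close>,
  restricted to positive crowding, the additive constant is replaced by the probability
  \<open>O (1 / n)\<close> of an accident, and a weighted probability of positive crowding is \<open>O (1 / n)\<close>
  (\<open>crowded_moment_decay\<close>). Then:

  \<^item> The probability of positive excess at time \<open>n\<close> tends to zero, so the excess vanishes infinitely
    often.

  \<^item> The probability that the excess passes from at most one to at least two between times \<open>n\<close> and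
    \<open>n + 1\<close> is \<open>O (1 / n\<^sup>2)\<close> (\<open>entrance_prob_decay\<close>). By Borel-Cantelli this happens finitely often,
    and since the excess returns to zero infinitely often, it is eventually at most one.

  \<^item> From any configuration at time \<open>n\<close>, the excess is positive two steps later with
    probability at least a constant times \<open>1 / n\<close> (\<open>two_transitions_widen\<close>). The harmonic series
    diverges, so the excess is positive infinitely often.
\<close>

section \<open>Holes of a configuration\<close>

definition holes :: "int set \<Rightarrow> int set" where
  "holes a = {y. y \<notin> a \<and> (\<exists>x\<in>a. x < y) \<and> (\<exists>x\<in>a. y < x)}"

definition excess :: "int set \<Rightarrow> nat" where
  "excess a = card {y \<in> holes a. y + 1 \<in> holes a}"

definition crowded :: "int set \<Rightarrow> int set" where
  "crowded a = {y \<in> holes a. y + 1 \<in> holes a \<or> y + 2 \<in> holes a}"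

text \<open>
  The sites counted by the excess are crowded, too, and count twice. This weight makes
  \<open>2 * card (holes a) - crowding a\<close> comparable to the size of the inner boundary: it is at most twice,
  and at least half of it (\<open>two_holes_le_crowding\<close>, \<open>crowding_le_holes\<close>).
\<close>

definition crowding :: "int set \<Rightarrow> nat" where
  "crowding a = excess a + card (crowded a)"

text \<open>
  The holes that an addition can fill. An addition picks one of these sites or one of the two
  outer neighbours of the configuration, all with equal probability.
\<close>

definition inner_boundary :: "int set \<Rightarrow> int set" where
  "inner_boundary a = site_boundary a \<inter> holes a"

lemma site_boundary_iff: "y \<in> site_boundary a \<longleftrightarrow> y \<notin> a \<and> (y + 1 \<in> a \<or> y - 1 \<in> a)"
proof -
  have "x = y + 1 \<or> x = y - 1" if "\<bar>x - y\<bar> = 1" for x using that by arith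
  then show ?thesis unfolding site_boundary_def by force
qed

lemma holesI: "y \<notin> a \<Longrightarrow> x \<in> a \<Longrightarrow> x < y \<Longrightarrow> z \<in> a \<Longrightarrow> y < z \<Longrightarrow> y \<in> holes a"
  by (auto simp: holes_def)

lemma finite_holes [simp]: "finite a \<Longrightarrow> finite (holes a)"
proof -
  assume a: "finite a"
  have "holes a \<subseteq> (\<Union>x\<in>a. \<Union>z\<in>a. {x..z})"
  proof
    fix y assume "y \<in> holes a"
    then obtain x z where "x \<in> a" "x < y" "z \<in> a" "y < z" unfolding holes_def by blast
    then have "y \<in> {x..z}" by simp
    then show "y \<in> (\<Union>x\<in>a. \<Union>z\<in>a. {x..z})" using \<open>x \<in> a\<close> \<open>z \<in> a\<close> by blast
  qed
  then show ?thesis using a by (meson finite_UN finite_atLeastAtMost_int finite_subset)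
qed

lemma finite_crowded [simp]: "finite a \<Longrightarrow> finite (crowded a)"
  by (simp add: crowded_def)

lemma finite_inner_boundary [simp]: "finite a \<Longrightarrow> finite (inner_boundary a)"
  by (simp add: inner_boundary_def)

lemma holes_alt:
  assumes "finite a" "a \<noteq> {}"
  shows "holes a = {Min a<..<Max a} - a"
proof -
  have "Min a \<in> a" "Max a \<in> a" using assms by auto
  moreover have "\<And>x. x \<in> a \<Longrightarrow> Min a \<le> x \<and> x \<le> Max a" using assms by auto
  ultimately show ?thesis unfolding holes_def by fastforce
qed

lemma site_boundary_decomp:
  assumes "finite a" "a \<noteq> {}"
  shows "site_boundary a = insert (Min a - 1) (insert (Max a + 1) (inner_boundary a))"
proof (intro equalityI subsetI)
  have mm: "Min a \<in> a" "Max a \<in> a" using assms by auto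
  have le: "\<And>x. x \<in> a \<Longrightarrow> Min a \<le> x \<and> x \<le> Max a" using assms by auto
  fix y
  {
    assume y: "y \<in> site_boundary a"
    then obtain x where x: "x \<in> a" "y \<notin> a" "\<bar>x - y\<bar> = 1" by (auto simp: site_boundary_def)
    consider "y < Min a" | "y > Max a" | "Min a \<le> y" "y \<le> Max a" by linarith
    then show "y \<in> insert (Min a - 1) (insert (Max a + 1) (inner_boundary a))"
    proof cases
      case 1 then show ?thesis using le[OF x(1)] x by auto
    next
      case 2 then show ?thesis using le[OF x(1)] x by auto
    next
      case 3
      moreover have "y \<noteq> Min a" "y \<noteq> Max a" using mm x(2) by auto
      ultimately have "y \<in> holes a" using mm x by (intro holesI[of _ _ "Min a" "Max a"]) auto
      then show ?thesis using y by (auto simp: inner_boundary_def)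
    qed
  }
  {
    assume "y \<in> insert (Min a - 1) (insert (Max a + 1) (inner_boundary a))"
    moreover have "Min a - 1 \<in> site_boundary a"
      using le[of "Min a - 1"] mm by (auto simp: site_boundary_def intro!: bexI[of _ "Min a"])
    moreover have "Max a + 1 \<in> site_boundary a"
      using le[of "Max a + 1"] mm by (auto simp: site_boundary_def intro!: bexI[of _ "Max a"])
    ultimately show "y \<in> site_boundary a" by (auto simp: inner_boundary_def)
  }
qed

lemma finite_site_boundary [simp]: "finite a \<Longrightarrow> finite (site_boundary a)"
proof (cases "a = {}")
  case True then show ?thesis by (simp add: site_boundary_def)
next
  case False
  moreover assume "finite a"
  ultimately show ?thesis by (simp add: site_boundary_decomp)
qed

lemma card_site_boundary:
  assumes "finite a" "a \<noteq> {}"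
  shows "card (site_boundary a) = card (inner_boundary a) + 2"
proof -
  have le: "\<And>x. x \<in> a \<Longrightarrow> Min a \<le> x \<and> x \<le> Max a" using assms by auto
  have "Min a \<le> Max a" using assms by simp
  moreover have "Min a - 1 \<notin> inner_boundary a" "Max a + 1 \<notin> inner_boundary a"
    using le by (auto simp: inner_boundary_def holes_def dest!: le)
  ultimately have "card (insert (Min a - 1) (insert (Max a + 1) (inner_boundary a))) = card (inner_boundary a) + 2"
    using assms(1) by (subst card_insert_disjoint) auto
  then show ?thesis unfolding site_boundary_decomp[OF assms] .
qed

lemma site_boundary_nonempty: "finite a \<Longrightarrow> a \<noteq> {} \<Longrightarrow> site_boundary a \<noteq> {}"
  by (simp add: site_boundary_decomp)

lemma card_inner_boundary_le: "finite a \<Longrightarrow> card (inner_boundary a) \<le> card (holes a)"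
  by (auto simp: inner_boundary_def intro: card_mono)

lemma hole_succ: "y \<in> holes a \<Longrightarrow> y + 1 \<notin> a \<Longrightarrow> y + 1 \<in> holes a"
proof -
  assume "y \<in> holes a" "y + 1 \<notin> a"
  then obtain x z where "y \<notin> a" "x \<in> a" "x < y" "z \<in> a" "y < z" "z \<noteq> y + 1" unfolding holes_def by blast
  then show ?thesis using \<open>y + 1 \<notin> a\<close> by (intro holesI[of _ _ x z]) auto
qed

lemma hole_pred: "y \<in> holes a \<Longrightarrow> y - 1 \<notin> a \<Longrightarrow> y - 1 \<in> holes a"
proof -
  assume "y \<in> holes a" "y - 1 \<notin> a"
  then obtain x z where "y \<notin> a" "x \<in> a" "x < y" "z \<in> a" "y < z" "x \<noteq> y - 1" unfolding holes_def by blast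
  then show ?thesis using \<open>y - 1 \<notin> a\<close> by (intro holesI[of _ _ x z]) auto
qed

text \<open>
  Every gap has one last and one first hole. Splitting the holes at either end of their gaps gives
  the same excess, because the two ways of pairing adjacent holes differ by a shift.
\<close>

lemma card_holes_split:
  assumes "finite a"
  shows "card (holes a) = excess a + card {y \<in> holes a. y + 1 \<in> a}"
proof -
  have "holes a = {y \<in> holes a. y + 1 \<in> holes a} \<union> {y \<in> holes a. y + 1 \<in> a}"
    using hole_succ by blast
  moreover have "{y \<in> holes a. y + 1 \<in> holes a} \<inter> {y \<in> holes a. y + 1 \<in> a} = {}"
    by (auto simp: holes_def)
  ultimately show ?thesis using assms unfolding excess_def
    by (metis (no_types, lifting) card_Un_disjoint finite_Un finite_holes)
qed

lemma card_holes_split':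
  assumes "finite a"
  shows "card (holes a) = excess a + card {y \<in> holes a. y - 1 \<in> a}"
proof -
  have "holes a = {y \<in> holes a. y - 1 \<in> holes a} \<union> {y \<in> holes a. y - 1 \<in> a}"
    using hole_pred by blast
  moreover have "{y \<in> holes a. y - 1 \<in> holes a} \<inter> {y \<in> holes a. y - 1 \<in> a} = {}"
    by (auto simp: holes_def)
  moreover have "{y \<in> holes a. y - 1 \<in> holes a} = (\<lambda>y. y + 1) ` {y \<in> holes a. y + 1 \<in> holes a}"
    by (auto simp: image_iff) (metis diff_add_cancel)
  then have "card {y \<in> holes a. y - 1 \<in> holes a} = excess a"
    by (simp add: card_image inj_on_def excess_def)
  ultimately show ?thesis using assms
    by (metis (no_types, lifting) card_Un_disjoint finite_Un finite_holes)
qed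

lemma card_holes_le_excess:
  assumes "finite a"
  shows "card (holes a) \<le> excess a + card (inner_boundary a)"
proof -
  have "{y \<in> holes a. y + 1 \<in> a} \<subseteq> inner_boundary a"
    by (auto simp: inner_boundary_def site_boundary_iff holes_def)
  then show ?thesis using card_holes_split[OF assms] card_mono[OF finite_inner_boundary[OF assms]] by simp
qed

lemma card_inner_boundary_excess:
  assumes "finite a"
  shows "card (inner_boundary a) + 2 * excess a \<le> 2 * card (holes a)"
proof -
  have "inner_boundary a \<subseteq> {y \<in> holes a. y + 1 \<in> a} \<union> {y \<in> holes a. y - 1 \<in> a}"
  proof
    fix y assume "y \<in> inner_boundary a"
    then show "y \<in> {y \<in> holes a. y + 1 \<in> a} \<union> {y \<in> holes a. y - 1 \<in> a}"
      by (auto simp: inner_boundary_def site_boundary_iff)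
  qed
  then have "card (inner_boundary a) \<le> card {y \<in> holes a. y + 1 \<in> a} + card {y \<in> holes a. y - 1 \<in> a}"
    using assms by (intro order_trans[OF card_mono card_Un_le]) auto
  then show ?thesis using card_holes_split[OF assms] card_holes_split'[OF assms] by linarith
qed

lemma excess_le_card_crowded: "finite a \<Longrightarrow> excess a \<le> card (crowded a)"
  unfolding excess_def crowded_def by (rule card_mono) auto

lemma card_crowded_le: "finite a \<Longrightarrow> card (crowded a) \<le> card (holes a)"
  unfolding crowded_def by (rule card_mono) auto

text \<open>
  If the inner boundary is small, the number of holes is controlled by the crowding.
\<close>

lemma two_holes_le_crowding:
  "finite a \<Longrightarrow> 2 * card (holes a) \<le> crowding a + 2 * card (inner_boundary a)"
  using card_holes_le_excess[of a] excess_le_card_crowded[of a] unfolding crowding_def by linarith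

text \<open>
  If the inner boundary is large, \<open>r ^ crowding a\<close> is negligible against \<open>r ^ (2 * card (holes a))\<close>.
\<close>

lemma crowding_le_holes:
  "finite a \<Longrightarrow> 2 * crowding a + card (inner_boundary a) \<le> 4 * card (holes a)"
  using card_inner_boundary_excess[of a] card_crowded_le[of a] by (simp add: crowding_def)

lemma crowding_eq_0_iff: "finite a \<Longrightarrow> crowding a = 0 \<longleftrightarrow> crowded a = {}"
  using excess_le_card_crowded[of a] by (auto simp: crowding_def)

text \<open>
  The endpoints are the nearest occupied sites on either side.
\<close>

lemma gap_around_hole:
  assumes "finite a" "y \<in> holes a"
  obtains l r where "l \<in> a" "r \<in> a" "l < y" "y < r" "{l<..<r} \<subseteq> holes a"
proof -
  define l where "l = Max {x \<in> a. x < y}"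
  define r where "r = Min {x \<in> a. y < x}"
  have "l \<in> {x \<in> a. x < y}" unfolding l_def using assms by (intro Max_in) (auto simp: holes_def)
  then have l: "l \<in> a" "l < y" by auto
  have "r \<in> {x \<in> a. y < x}" unfolding r_def using assms by (intro Min_in) (auto simp: holes_def)
  then have r: "r \<in> a" "y < r" by auto
  have lm: "z \<le> l" if "z \<in> a" "z < y" for z unfolding l_def using that assms by (intro Max_ge) auto
  have rm: "r \<le> z" if "z \<in> a" "y < z" for z unfolding r_def using that assms by (intro Min_le) auto
  have "{l<..<r} \<subseteq> holes a"
  proof
    fix z assume z: "z \<in> {l<..<r}"
    have "z \<notin> a"
    proof
      assume za: "z \<in> a"
      then have "z \<noteq> y" using assms by (auto simp: holes_def)
      then consider "z < y" | "y < z" by linarith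
      then show False using lm[OF za] rm[OF za] z by cases auto
    qed
    then show "z \<in> holes a" using z l r by (intro holesI[of _ _ l r]) auto
  qed
  then show ?thesis using that l r by blast
qed

section \<open>The effect of one addition\<close>

text \<open>
  Sites outside the hull that an addition can choose are adjacent to it, so that no hole is
  created by extending the hull.
\<close>

lemma holes_insert:
  assumes "y \<in> site_boundary a"
  shows "holes (insert y a) = holes a - {y}"
proof -
  obtain x where x: "x \<in> a" "x = y + 1 \<or> x = y - 1" "y \<notin> a"
    using assms unfolding site_boundary_iff by blast
  have 1: "\<exists>w\<in>a. w < z" if "y < z" "z \<notin> a" for z
  proof (intro bexI[of _ x])
    have "z \<noteq> x" using that x by blast
    then show "x < z" using that x(2) by linarith
  qed (rule x(1))
  have 2: "\<exists>w\<in>a. z < w" if "z < y" "z \<notin> a" for z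
  proof (intro bexI[of _ x])
    have "z \<noteq> x" using that x by blast
    then show "z < x" using that x(2) by linarith
  qed (rule x(1))
  show ?thesis using 1 2 by (auto simp: holes_def)
qed

lemma excess_insert_le: "finite a \<Longrightarrow> y \<in> site_boundary a \<Longrightarrow> excess (insert y a) \<le> excess a"
  unfolding excess_def by (rule card_mono) (auto simp: holes_insert)

lemma crowded_insert: "y \<in> site_boundary a \<Longrightarrow> crowded (insert y a) \<subseteq> crowded a - {y}"
  by (auto simp: crowded_def holes_insert)

lemma crowding_insert_le:
  assumes "finite a" "y \<in> site_boundary a"
  shows "crowding (insert y a) \<le> crowding a"
proof -
  have "card (crowded (insert y a)) \<le> card (crowded a)"
    using crowded_insert[OF assms(2)] assms by (intro card_mono) auto
  then show ?thesis using excess_insert_le[OF assms] unfolding crowding_def by linarith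
qed

lemma crowding_insert_less:
  assumes "finite a" "y \<in> site_boundary a" "y \<in> crowded a"
  shows "crowding (insert y a) + 1 \<le> crowding a"
proof -
  have "card (crowded (insert y a)) < card (crowded a)"
    using crowded_insert[OF assms(2)] assms by (intro psubset_card_mono) auto
  then show ?thesis using excess_insert_le[OF assms(1,2)] unfolding crowding_def by linarith
qed

text \<open>
  The leftmost crowded site has an occupied left neighbour. Filling it decreases the crowding,
  so a positive crowding drops with probability at least one over the size of the boundary.
\<close>

lemma crowded_meets_boundary:
  assumes "finite a" "crowded a \<noteq> {}"
  shows "\<exists>y\<in>crowded a. y \<in> site_boundary a"
proof -
  define y where "y = Min (crowded a)"
  have y: "y \<in> crowded a" unfolding y_def using assms by simp
  then have yh: "y \<in> holes a" by (simp add: crowded_def)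
  have mn: "y - 1 \<notin> crowded a"
    using Min_le[OF finite_crowded[OF assms(1)], of "y - 1"] unfolding y_def by auto
  have "y - 1 \<in> a"
  proof (rule ccontr)
    assume "y - 1 \<notin> a"
    then have "y - 1 \<in> holes a" by (rule hole_pred[OF yh])
    then have "y - 1 \<in> crowded a" using yh by (simp add: crowded_def)
    then show False using mn by contradiction
  qed
  then have "y \<in> site_boundary a" using yh by (simp add: site_boundary_iff holes_def)
  then show ?thesis using y by blast
qed

lemma inner_boundary_insert_ge:
  assumes "finite a" "y \<in> site_boundary a"
  shows "card (inner_boundary a) \<le> card (inner_boundary (insert y a)) + 1"
proof -
  have "inner_boundary a \<subseteq> insert y (inner_boundary (insert y a))"
    unfolding inner_boundary_def holes_insert[OF assms(2)] by (force simp only: site_boundary_iff insert_iff Int_iff Diff_iff empty_iff)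
  then have "card (inner_boundary a) \<le> card (insert y (inner_boundary (insert y a)))"
    using assms by (intro card_mono) auto
  also have "\<dots> \<le> card (inner_boundary (insert y a)) + 1" using card_insert_le_m1 
    by (simp add: assms(1) card_insert_if)
  finally show ?thesis .
qed

lemma inner_boundary_insert_le:
  assumes "finite a" "y \<in> site_boundary a"
  shows "card (inner_boundary (insert y a)) \<le> card (inner_boundary a) + 2"
proof -
  have "inner_boundary (insert y a) \<subseteq> insert (y - 1) (insert (y + 1) (inner_boundary a))"
  proof
    fix z assume "z \<in> inner_boundary (insert y a)"
    then have "z \<in> holes a" "z \<notin> a" "z + 1 = y \<or> z - 1 = y \<or> z + 1 \<in> a \<or> z - 1 \<in> a"
      unfolding inner_boundary_def holes_insert[OF assms(2)] site_boundary_iff Int_iff Diff_iff by blast+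
    moreover have "z + 1 = y \<Longrightarrow> z = y - 1" "z - 1 = y \<Longrightarrow> z = y + 1" by linarith+
    ultimately show "z \<in> insert (y - 1) (insert (y + 1) (inner_boundary a))"
      unfolding inner_boundary_def site_boundary_iff Int_iff insert_iff by blast
  qed
  then have "card (inner_boundary (insert y a)) \<le> card (insert (y - 1) (insert (y + 1) (inner_boundary a)))"
    using assms by (intro card_mono) auto
  also have "\<dots> \<le> card (inner_boundary a) + 2" using assms by (simp add: card_insert_if)
  finally show ?thesis .
qed

section \<open>The effect of one deletion\<close>

text \<open>
  If an endpoint is deleted, the hull may shrink and holes may disappear, but no hole other than
  the deleted site can appear.
\<close>

lemma holes_delete: "holes (a - {x}) \<subseteq> insert x (holes a)"
  by (auto simp: holes_def)

lemma holes_delete_interior: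
  assumes "x \<in> a" "\<exists>w\<in>a. w < x" "\<exists>w\<in>a. x < w"
  shows "holes (a - {x}) = insert x (holes a)"
proof -
  obtain u v where uv: "u \<in> a" "u < x" "v \<in> a" "x < v" using assms by blast
  have "\<exists>w\<in>a - {x}. w < z" if "\<exists>w\<in>a. w < z" for z using that uv by (metis DiffI less_trans less_irrefl singletonD)
  moreover have "\<exists>w\<in>a - {x}. z < w" if "\<exists>w\<in>a. z < w" for z using that uv by (metis DiffI less_trans less_irrefl singletonD)
  ultimately show ?thesis using assms by (auto simp: holes_def)
qed

lemma card_holes_delete: "finite a \<Longrightarrow> card (holes (a - {x})) \<le> card (holes a) + 1"
  by (rule order_trans[OF card_mono[OF _ holes_delete[of a x]]]) (simp_all add: card_insert_if)

lemma inner_boundary_delete: 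
  assumes "finite a"
  shows "card (inner_boundary (a - {x})) \<le> card (inner_boundary a) + 1"
proof -
  have "inner_boundary (a - {x}) \<subseteq> insert x (inner_boundary a)"
  proof
    fix z assume "z \<in> inner_boundary (a - {x})"
    then have z: "z \<in> holes (a - {x})" "z + 1 \<in> a \<or> z - 1 \<in> a"
      by (simp_all add: inner_boundary_def site_boundary_iff) blast
    from z(1) have "z = x \<or> z \<in> holes a" using holes_delete by blast
    then show "z \<in> insert x (inner_boundary a)"
    proof
      assume h: "z \<in> holes a"
      then have "z \<notin> a" by (simp add: holes_def)
      with h z(2) show ?thesis by (simp add: inner_boundary_def site_boundary_iff)
    qed simp
  qed
  then have "card (inner_boundary (a - {x})) \<le> card (insert x (inner_boundary a))"
    using assms by (intro card_mono) auto
  also have "\<dots> \<le> card (inner_boundary a) + 1" using assms by (simp add: card_insert_if)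
  finally show ?thesis .
qed

lemma crowding_delete_le:
  assumes "finite a"
  shows "crowding (a - {x}) \<le> crowding a + 5"
proof -
  have h: "z = x \<or> z \<in> holes a" if "z \<in> holes (a - {x})" for z using holes_delete that by blast
  have "{y \<in> holes (a - {x}). y + 1 \<in> holes (a - {x})}
      \<subseteq> insert x (insert (x - 1) {y \<in> holes a. y + 1 \<in> holes a})" by (auto dest!: h)
  then have "excess (a - {x}) \<le> card (insert x (insert (x - 1) {y \<in> holes a. y + 1 \<in> holes a}))"
    unfolding excess_def using assms by (intro card_mono) auto
  also have "\<dots> \<le> excess a + 2" using assms by (simp add: card_insert_if excess_def)
  finally have 1: "excess (a - {x}) \<le> excess a + 2" .
  have "crowded (a - {x}) \<subseteq> insert x (insert (x - 1) (insert (x - 2) (crowded a)))"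
    by (auto simp: crowded_def dest!: h)
  then have "card (crowded (a - {x})) \<le> card (insert x (insert (x - 1) (insert (x - 2) (crowded a))))"
    using assms by (intro card_mono) auto
  also have "\<dots> \<le> card (crowded a) + 3" using assms by (simp add: card_insert_if)
  finally show ?thesis using 1 unfolding crowding_def by simp
qed

text \<open>
  The occupied sites whose deletion may increase the crowding: some hole is within distance two.
\<close>

definition exposed :: "int set \<Rightarrow> int set" where
  "exposed a = {x \<in> a. {x - 2, x - 1, x + 1, x + 2} \<inter> holes a \<noteq> {}}"

text \<open>
  The hole nearest to an exposed site, on the side where it is exposed, belongs to the inner
  boundary.
\<close>

lemma card_exposed_le:
  assumes "finite a"
  shows "card (exposed a) \<le> 4 * card (inner_boundary a)"
proof -
  have "exposed a \<subseteq> (\<Union>y\<in>inner_boundary a. {y - 2, y - 1, y + 1, y + 2})"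
  proof
    fix x assume "x \<in> exposed a"
    then have x: "x \<in> a" and c: "x - 2 \<in> holes a \<or> x - 1 \<in> holes a \<or> x + 1 \<in> holes a \<or> x + 2 \<in> holes a"
      by (auto simp: exposed_def)
    have 1: "x - 1 \<in> inner_boundary a" if "x - 1 \<in> holes a"
      using that x by (simp add: inner_boundary_def site_boundary_iff holes_def)
    have 2: "x + 1 \<in> inner_boundary a" if "x + 1 \<in> holes a"
      using that x by (simp add: inner_boundary_def site_boundary_iff holes_def)
    have 3: "x - 2 \<in> inner_boundary a" if "x - 2 \<in> holes a" "x - 1 \<notin> holes a"
    proof -
      have "x - 1 \<in> a" using hole_succ[OF that(1)] that(2) by (auto simp: diff_add_eq)
      then show ?thesis using that by (simp add: inner_boundary_def site_boundary_iff holes_def)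
    qed
    have 4: "x + 2 \<in> inner_boundary a" if "x + 2 \<in> holes a" "x + 1 \<notin> holes a"
    proof -
      have "x + 2 - 1 = x + 1" by simp
      then have "x + 2 - 1 \<in> a" using hole_pred[OF that(1)] that(2) by metis
      then show ?thesis using that(1) unfolding inner_boundary_def site_boundary_iff Int_iff holes_def by blast
    qed
    consider "x - 1 \<in> inner_boundary a" | "x + 1 \<in> inner_boundary a" | "x - 2 \<in> inner_boundary a" | "x + 2 \<in> inner_boundary a"
      using 1 2 3 4 c by blast
    then show "x \<in> (\<Union>y\<in>inner_boundary a. {y - 2, y - 1, y + 1, y + 2})"
    proof cases
      case 1 show ?thesis by (rule UN_I[OF 1]) simp
    next
      case 2 show ?thesis by (rule UN_I[OF 2]) simp
    next
      case 3 show ?thesis by (rule UN_I[OF 3]) simp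
    next
      case 4 show ?thesis by (rule UN_I[OF 4]) simp
    qed
  qed
  then have "card (exposed a) \<le> card (\<Union>y\<in>inner_boundary a. {y - 2, y - 1, y + 1, y + 2})"
    using assms by (intro card_mono) auto
  also have "\<dots> \<le> (\<Sum>y\<in>inner_boundary a. card {y - 2, y - 1, y + 1, y + 2})"
    using assms by (intro card_UN_le) simp
  also have "\<dots> \<le> (\<Sum>y\<in>inner_boundary a. 4)"
    by (intro sum_mono) (simp add: card_insert_if)
  finally show ?thesis by simp
qed

lemma delete_unexposed:
  assumes "finite a" "x \<in> a" "x \<notin> exposed a"
  shows "excess (a - {x}) \<le> excess a" "crowding (a - {x}) \<le> crowding a"
proof -
  have h: "z = x \<or> z \<in> holes a" if "z \<in> holes (a - {x})" for z using holes_delete that by blast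
  have n: "x - 2 \<notin> holes a" "x - 1 \<notin> holes a" "x + 1 \<notin> holes a" "x + 2 \<notin> holes a"
    using assms by (auto simp: exposed_def)
  then have n': "x \<noteq> y + 1" "x \<noteq> y + 2" if "y \<in> holes a" for y using that by auto
  have "{y \<in> holes (a - {x}). y + 1 \<in> holes (a - {x})} \<subseteq> {y \<in> holes a. y + 1 \<in> holes a}"
    using n n' by (auto dest!: h)
  then show 1: "excess (a - {x}) \<le> excess a" unfolding excess_def using assms(1) by (intro card_mono) auto
  have "crowded (a - {x}) \<subseteq> crowded a" using n n' unfolding crowded_def by (auto dest!: h)
  then have "card (crowded (a - {x})) \<le> card (crowded a)" using assms(1) by (intro card_mono) auto
  then show "crowding (a - {x}) \<le> crowding a" using 1 unfolding crowding_def by simp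
qed

text \<open>
  If all holes are at distance at least three, one more hole has at most one adjacent hole.
\<close>

lemma excess_delete_uncrowded:
  assumes "finite a" "crowding a = 0"
  shows "excess (a - {x}) \<le> 1"
proof -
  have h: "z = x \<or> z \<in> holes a" if "z \<in> holes (a - {x})" for z using holes_delete that by blast
  have c: "crowded a = {}" using assms crowding_eq_0_iff by blast
  then have c1: "y + 1 \<notin> holes a" "y + 2 \<notin> holes a" if "y \<in> holes a" for y
    using that by (auto simp: crowded_def)
  have sub: "{y \<in> holes (a - {x}). y + 1 \<in> holes (a - {x})} \<subseteq> {x, x - 1}" using c1 by (auto dest!: h)
  have "\<not> (x - 1 \<in> holes (a - {x}) \<and> x + 1 \<in> holes (a - {x}))"
  proof
    assume *: "x - 1 \<in> holes (a - {x}) \<and> x + 1 \<in> holes (a - {x})"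
    have "x - 1 \<noteq> x" "x + 1 \<noteq> x" by auto
    then have "x - 1 \<in> holes a" "x + 1 \<in> holes a" using h * by blast+
    moreover have "x - 1 + 2 = x + 1" by simp
    ultimately show False using c1(2)[of "x - 1"] by metis
  qed
  then have "{y \<in> holes (a - {x}). y + 1 \<in> holes (a - {x})} \<subseteq> {x} \<or> 
    {y \<in> holes (a - {x}). y + 1 \<in> holes (a - {x})} \<subseteq> {x - 1}" using sub by auto
  then show ?thesis unfolding excess_def using card_mono[of "{x}"] card_mono[of "{x - 1}"] by fastforce
qed

text \<open>
  Removing an endpoint of a gap widens it, unless that endpoint is also an endpoint of the
  configuration. If this is so at both ends, the configuration consists of these two sites.
\<close>

lemma exists_widening_deletion:
  assumes "finite a" "card a \<ge> 3" "holes a \<noteq> {}"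
  shows "\<exists>x\<in>a. excess (a - {x}) \<ge> 1"
proof -
  obtain y where y: "y \<in> holes a" using assms by blast
  obtain l r where lr: "l \<in> a" "r \<in> a" "l < y" "y < r" and gap: "{l<..<r} \<subseteq> holes a"
    using gap_around_hole[OF assms(1) y] by blast
  have lh: "l + 1 \<in> holes a" and rh: "r - 1 \<in> holes a" using gap lr by auto
  show ?thesis
  proof (cases "\<exists>w\<in>a. w < l")
    case True
    have "\<exists>w\<in>a. l < w" using lr by (intro bexI[of _ r]) auto
    then have "holes (a - {l}) = insert l (holes a)" using True lr by (intro holes_delete_interior) auto
    then have "{l} \<subseteq> {y \<in> holes (a - {l}). y + 1 \<in> holes (a - {l})}" using lh by auto
    from card_mono[OF _ this] have "excess (a - {l}) \<ge> 1" using assms by (simp add: excess_def)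
    then show ?thesis using lr by blast
  next
    case nl: False
    show ?thesis
    proof (cases "\<exists>w\<in>a. r < w")
      case True
      have "\<exists>w\<in>a. w < r" using lr by (intro bexI[of _ l]) auto
      then have "holes (a - {r}) = insert r (holes a)" using True lr by (intro holes_delete_interior) auto
      then have "{r - 1} \<subseteq> {y \<in> holes (a - {r}). y + 1 \<in> holes (a - {r})}" using rh by auto
      from card_mono[OF _ this] have "excess (a - {r}) \<ge> 1" using assms by (simp add: excess_def)
      then show ?thesis using lr by blast
    next
      case False
      have "a \<subseteq> {l, r}"
      proof
        fix z assume z: "z \<in> a"
        then have "z \<notin> {l<..<r}" using gap by (auto simp: holes_def)
        then show "z \<in> {l, r}" using nl False z by (metis greaterThanLessThan_iff insertCI linorder_neqE)
      qed
      then have "card a \<le> card {l, r}" by (intro card_mono) auto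
      also have "\<dots> \<le> 2" by (simp add: card_insert_if)
      finally show ?thesis using assms by simp
    qed
  qed
qed

section \<open>Gaps in terms of holes\<close>

lemma gapI: "l \<in> a \<Longrightarrow> r \<in> a \<Longrightarrow> l < y \<Longrightarrow> y < r \<Longrightarrow> {l<..<r} \<subseteq> holes a \<Longrightarrow> {l<..<r} \<in> gaps a"
  unfolding gaps_def holes_def by auto

lemma gapE:
  assumes "g \<in> gaps a"
  obtains l r where "l \<in> a" "r \<in> a" "l + 1 < r" "{l<..<r} \<subseteq> holes a" "g = {l<..<r}"
proof -
  obtain l r where g: "g \<noteq> {}" "g \<subseteq> - a" "l \<in> a" "r \<in> a" "g = {l<..<r}" using assms by (auto simp: gaps_def)
  then obtain z where "l < z" "z < r" by auto
  then have "l + 1 < r" by linarith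
  moreover have "{l<..<r} \<subseteq> holes a" using g unfolding holes_def by auto
  ultimately show ?thesis using that g by blast
qed

lemma finite_gaps: "finite a \<Longrightarrow> finite (gaps a)"
  by (rule finite_subset[of _ "Pow (holes a)"]) (auto elim!: gapE)

lemma num_unoccupied_eq: "finite a \<Longrightarrow> a \<noteq> {} \<Longrightarrow> num_unoccupied a = card (holes a)"
  by (simp add: num_unoccupied_def holes_alt)

text \<open>
  The holes that do not count for the excess are the last holes of gaps.
\<close>

lemma num_unoccupied_le:
  assumes "finite a" "a \<noteq> {}"
  shows "num_unoccupied a \<le> excess a + num_gaps a"
proof -
  have "\<exists>g\<in>gaps a. Max g = y" if y: "y \<in> holes a" "y + 1 \<in> a" for y
  proof -
    obtain l r where lr: "l \<in> a" "r \<in> a" "l < y" "y < r" and gap: "{l<..<r} \<subseteq> holes a"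
      using gap_around_hole[OF assms(1) y(1)] by blast
    have "r = y + 1"
    proof (rule ccontr)
      assume "r \<noteq> y + 1"
      then have "y + 1 \<in> {l<..<r}" using lr by auto
      then have "y + 1 \<in> holes a" using gap by blast
      then show False using y by (simp add: holes_def)
    qed
    moreover have "Max {l<..<y + 1} = y" using lr by (intro Max_eqI) auto
    ultimately show ?thesis using gapI[OF lr gap] by auto
  qed
  then have "{y \<in> holes a. y + 1 \<in> a} \<subseteq> Max ` gaps a" by blast
  then have "card {y \<in> holes a. y + 1 \<in> a} \<le> num_gaps a"
    using finite_gaps[OF assms(1)] unfolding num_gaps_def by (meson surj_card_le)
  then show ?thesis using card_holes_split[OF assms(1)] num_unoccupied_eq[OF assms] by simp
qed

text \<open>
  The first hole of a gap of size at least two counts for the excess, and it determines the gap.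
\<close>

lemma num_gaps2_le_excess:
  assumes "finite a"
  shows "num_gaps2 a \<le> excess a"
proof -
  have Mn: "Min {l<..<r} = l + 1" if "l + 1 < r" for l r :: int using that by (intro Min_eqI) auto
  have "inj_on Min (gaps a)"
  proof (rule inj_onI)
    fix g h assume "g \<in> gaps a" "h \<in> gaps a" and eq: "Min g = Min h"
    then obtain l r l' r' where
      g: "l \<in> a" "r \<in> a" "l + 1 < r" "{l<..<r} \<subseteq> holes a" "g = {l<..<r}" and
      h: "l' \<in> a" "r' \<in> a" "l' + 1 < r'" "{l'<..<r'} \<subseteq> holes a" "h = {l'<..<r'}"
      by (metis gapE)
    have ll: "l = l'" using eq g(3,5) h(3,5) Mn by simp
    have "r \<notin> {l'<..<r'}" "r' \<notin> {l<..<r}" using g h by (auto simp: holes_def)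
    then have "r = r'" using ll g(3) h(3) by auto
    then show "g = h" using ll g h by simp
  qed
  then have inj: "inj_on Min {g \<in> gaps a. 2 \<le> card g}" by (rule inj_on_subset) auto
  have "Min g \<in> holes a \<and> Min g + 1 \<in> holes a" if "g \<in> gaps a" "2 \<le> card g" for g
  proof -
    obtain l r where g: "l \<in> a" "r \<in> a" "l + 1 < r" "{l<..<r} \<subseteq> holes a" "g = {l<..<r}"
      using gapE \<open>g \<in> gaps a\<close> by metis
    have "l + 2 < r" using that(2) g(3,5) by auto
    then have "l + 1 \<in> {l<..<r}" "l + 1 + 1 \<in> {l<..<r}" by auto
    then show ?thesis using g Mn by auto
  qed
  then show ?thesis unfolding num_gaps2_def excess_def using assms
    by (intro card_inj_on_le[OF inj]) auto
qed

lemma num_gaps2_pos: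
  assumes "finite a" "excess a \<ge> 1"
  shows "num_gaps2 a \<ge> 1"
proof -
  have "{y \<in> holes a. y + 1 \<in> holes a} \<noteq> {}" using assms unfolding excess_def by force
  then obtain y where y: "y \<in> holes a" "y + 1 \<in> holes a" by blast
  obtain l r where lr: "l \<in> a" "r \<in> a" "l < y" "y < r" and gap: "{l<..<r} \<subseteq> holes a"
    using gap_around_hole[OF assms(1) y(1)] by blast
  have "r \<noteq> y + 1" using lr y by (auto simp: holes_def)
  then have "{y, y + 1} \<subseteq> {l<..<r}" using lr by auto
  from card_mono[OF _ this] have "2 \<le> card {l<..<r}" by (simp del: card_greaterThanLessThan_int)
  then have "{{l<..<r}} \<subseteq> {g \<in> gaps a. 2 \<le> card g}" using gapI[OF lr gap] by blast
  from card_mono[OF _ this] show ?thesis using finite_gaps[OF assms(1)] by (simp add: num_gaps2_def)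
qed

section \<open>One addition and one deletion in expectation\<close>

lemma expectation_mono_pmf:
  fixes f g :: "'a \<Rightarrow> real"
  assumes "finite (set_pmf p)" "\<And>a. a \<in> set_pmf p \<Longrightarrow> f a \<le> g a"
  shows "measure_pmf.expectation p f \<le> measure_pmf.expectation p g"
  using assms by (intro integral_mono_AE) (auto simp: AE_measure_pmf_iff integrable_measure_pmf_finite)

lemma expectation_bind_pmf:
  fixes f :: "'b \<Rightarrow> real"
  assumes "finite (set_pmf p)" "\<And>a. a \<in> set_pmf p \<Longrightarrow> finite (set_pmf (k a))"
  shows "measure_pmf.expectation (bind_pmf p k) f =
    measure_pmf.expectation p (\<lambda>a. measure_pmf.expectation (k a) f)"
proof -
  have "measure_pmf.expectation (bind_pmf p k) f =
      (\<Sum>a\<in>set_pmf p. pmf p a *\<^sub>R measure_pmf.expectation (k a) f)"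
    by (rule pmf_expectation_bind) (use assms in auto)
  also have "\<dots> = measure_pmf.expectation p (\<lambda>a. measure_pmf.expectation (k a) f)"
    by (rule integral_measure_pmf[symmetric]) (use assms in auto)
  finally show ?thesis .
qed

lemma expectation_bind_le:
  fixes f :: "'b \<Rightarrow> real"
  assumes "finite (set_pmf p)" "\<And>a. a \<in> set_pmf p \<Longrightarrow> finite (set_pmf (k a))"
    "\<And>a. a \<in> set_pmf p \<Longrightarrow> measure_pmf.expectation (k a) f \<le> g a"
  shows "measure_pmf.expectation (bind_pmf p k) f \<le> measure_pmf.expectation p g"
  using assms by (simp add: expectation_bind_pmf expectation_mono_pmf)

lemma expectation_bind_ge:
  fixes f :: "'b \<Rightarrow> real"
  assumes "finite (set_pmf p)" "\<And>a. a \<in> set_pmf p \<Longrightarrow> finite (set_pmf (k a))"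
    "\<And>a. a \<in> set_pmf p \<Longrightarrow> g a \<le> measure_pmf.expectation (k a) f"
  shows "measure_pmf.expectation p g \<le> measure_pmf.expectation (bind_pmf p k) f"
  using assms by (simp add: expectation_bind_pmf expectation_mono_pmf)

lemma set_add_site:
  "finite a \<Longrightarrow> a \<noteq> {} \<Longrightarrow> set_pmf (add_site a) = (\<lambda>y. insert y a) ` site_boundary a"
  by (simp add: add_site_def site_boundary_nonempty)

lemma set_delete_site:
  "finite a \<Longrightarrow> a \<noteq> {} \<Longrightarrow> set_pmf (delete_site a) = (\<lambda>x. a - {x}) ` a"
  by (simp add: delete_site_def)

lemma expectation_add_site:
  fixes f :: "int set \<Rightarrow> real"
  assumes "finite a" "a \<noteq> {}"
  shows "measure_pmf.expectation (add_site a) f =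
    (\<Sum>y\<in>site_boundary a. f (insert y a)) / (card (inner_boundary a) + 2)"
  using assms by (simp add: add_site_def integral_pmf_of_set site_boundary_nonempty card_site_boundary)

lemma expectation_delete_site:
  fixes f :: "int set \<Rightarrow> real"
  assumes "finite a" "a \<noteq> {}"
  shows "measure_pmf.expectation (delete_site a) f = (\<Sum>x\<in>a. f (a - {x})) / card a"
  using assms by (simp add: delete_site_def integral_pmf_of_set)

text \<open>
  If the inner boundary is large, almost every addition fills a hole.
\<close>

lemma add_site_power_holes_le:
  fixes s :: real
  assumes "finite a" "a \<noteq> {}" "s \<ge> 1"
  shows "measure_pmf.expectation (add_site a) (\<lambda>b. s ^ card (holes b))
    \<le> s ^ card (holes a) * ((1 / s) * (1 + 2 * (s - 1) / (card (inner_boundary a) + 2)))"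
proof -
  let ?L = "card (holes a)" and ?\<beta> = "card (inner_boundary a)"
  have fin: "finite (site_boundary a)" using assms by simp
  have sub: "inner_boundary a \<subseteq> site_boundary a" by (auto simp: inner_boundary_def)
  have card2: "card (site_boundary a - inner_boundary a) = 2"
    using sub assms by (simp add: card_Diff_subset card_site_boundary)
  have in1: "s ^ card (holes (insert y a)) = s ^ ?L / s" if y: "y \<in> inner_boundary a" for y
  proof -
    have "y \<in> holes a" "y \<in> site_boundary a" using y by (auto simp: inner_boundary_def)
    then have "Suc (card (holes (insert y a))) = ?L" using assms(1)
      by (simp only: holes_insert) (rule card_Suc_Diff1, auto)
    then have "s ^ ?L = s * s ^ card (holes (insert y a))" by (metis power_Suc)
    then show ?thesis using assms by simp
  qed
  have out: "s ^ card (holes (insert y a)) \<le> s ^ ?L" if y: "y \<in> site_boundary a" for y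
    using assms y by (intro power_increasing card_mono) (auto simp: holes_insert)
  have "(\<Sum>y\<in>site_boundary a. s ^ card (holes (insert y a)))
      = (\<Sum>y\<in>site_boundary a - inner_boundary a. s ^ card (holes (insert y a)))
        + (\<Sum>y\<in>inner_boundary a. s ^ card (holes (insert y a)))"
    using sum.subset_diff[OF sub fin] by blast
  also have "\<dots> \<le> (\<Sum>y\<in>site_boundary a - inner_boundary a. s ^ ?L) + (\<Sum>y\<in>inner_boundary a. s ^ ?L / s)"
    by (intro add_mono sum_mono) (use in1 out in auto)
  also have "\<dots> = s ^ ?L * (2 + ?\<beta> / s)" using card2 by (simp add: algebra_simps)
  finally have "(\<Sum>y\<in>site_boundary a. s ^ card (holes (insert y a))) / (?\<beta> + 2)
      \<le> s ^ ?L * (2 + ?\<beta> / s) / (?\<beta> + 2)" by (intro divide_right_mono) auto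
  also have "\<dots> = s ^ ?L * ((1 / s) * (1 + 2 * (s - 1) / (?\<beta> + 2)))"
    using assms by (simp add: field_simps)
  finally show ?thesis using assms by (simp add: expectation_add_site)
qed

lemma add_site_power_crowding_le:
  fixes r :: real
  assumes "finite a" "a \<noteq> {}" "r \<ge> 2" "crowding a \<ge> 1"
  shows "measure_pmf.expectation (add_site a) (\<lambda>b. r ^ crowding b)
    \<le> r ^ crowding a * (1 - 1 / (2 * (card (inner_boundary a) + 2)))"
proof -
  let ?X = "crowding a" and ?\<beta> = "card (inner_boundary a)"
  obtain y where y: "y \<in> crowded a" "y \<in> site_boundary a"
    using crowded_meets_boundary crowding_eq_0_iff assms by (metis not_one_le_zero)
  have fin: "finite (site_boundary a)" using assms by simp
  have drop: "r ^ crowding (insert y a) \<le> r ^ ?X / 2"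
  proof -
    have "2 * r ^ crowding (insert y a) \<le> r * r ^ crowding (insert y a)" using assms by (intro mult_right_mono) auto
    also have "\<dots> = r ^ (crowding (insert y a) + 1)" by simp
    also have "\<dots> \<le> r ^ ?X" using assms y by (intro power_increasing crowding_insert_less) auto
    finally show ?thesis by simp
  qed
  have "(\<Sum>z\<in>site_boundary a. r ^ crowding (insert z a))
      = r ^ crowding (insert y a) + (\<Sum>z\<in>site_boundary a - {y}. r ^ crowding (insert z a))"
    using sum.remove[OF fin y(2)] by blast
  also have "\<dots> \<le> r ^ ?X / 2 + (\<Sum>z\<in>site_boundary a - {y}. r ^ ?X)"
    using assms drop by (intro add_mono sum_mono power_increasing crowding_insert_le) auto
  also have "\<dots> = r ^ ?X * (?\<beta> + 2 - 1 / 2)"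
    using y assms by (simp add: card_site_boundary algebra_simps)
  finally have "(\<Sum>z\<in>site_boundary a. r ^ crowding (insert z a)) / (?\<beta> + 2)
      \<le> r ^ ?X * (?\<beta> + 2 - 1 / 2) / (?\<beta> + 2)" by (intro divide_right_mono) auto
  also have "\<dots> = r ^ ?X * (1 - 1 / (2 * (?\<beta> + 2)))" by (simp add: field_simps)
  finally show ?thesis using assms by (simp add: expectation_add_site)
qed

text \<open>
  The general form of the estimate that a bad effect of a deletion, bounded by \<open>B\<close>, requires an
  exposed site to be chosen.
\<close>

lemma delete_site_le:
  fixes f :: "int set \<Rightarrow> real"
  assumes "finite a" "a \<noteq> {}" "B \<ge> 0"
    and "\<And>x. x \<in> a \<Longrightarrow> x \<notin> exposed a \<Longrightarrow> f (a - {x}) \<le> c"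
    and "\<And>x. x \<in> a \<Longrightarrow> f (a - {x}) \<le> c + B"
  shows "measure_pmf.expectation (delete_site a) f \<le> c + B * (4 * card (inner_boundary a) / card a)"
proof -
  have sub: "exposed a \<subseteq> a" by (auto simp: exposed_def)
  have pos: "card a > 0" using assms by auto
  have "(\<Sum>x\<in>a. f (a - {x})) \<le> (\<Sum>x\<in>a. c + (if x \<in> exposed a then B else 0))"
    by (intro sum_mono) (use assms in auto)
  also have "\<dots> = card a * c + card (exposed a) * B"
    using assms(1) sub by (simp add: sum.distrib sum.If_cases Int_absorb1)
  also have "\<dots> \<le> card a * c + real (4 * card (inner_boundary a)) * B"
    using card_exposed_le[OF assms(1)] assms(3) by (intro add_left_mono mult_right_mono) (auto simp only: of_nat_le_iff)
  finally have "(\<Sum>x\<in>a. f (a - {x})) / card a \<le> (card a * c + 4 * card (inner_boundary a) * B) / card a"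
    by (intro divide_right_mono) auto
  also have "\<dots> = c + B * (4 * card (inner_boundary a) / card a)" using pos by (simp add: field_simps)
  finally show ?thesis using assms by (simp add: expectation_delete_site)
qed

lemma delete_site_power_crowding_le:
  fixes r :: real
  assumes "finite a" "a \<noteq> {}" "r \<ge> 1"
  shows "measure_pmf.expectation (delete_site a) (\<lambda>b. r ^ crowding b)
    \<le> r ^ crowding a * (1 + 4 * r ^ 5 * card (inner_boundary a) / card a)"
proof -
  have "measure_pmf.expectation (delete_site a) (\<lambda>b. r ^ crowding b)
    \<le> r ^ crowding a + r ^ (crowding a + 5) * (4 * card (inner_boundary a) / card a)"
  proof (rule delete_site_le)
    fix x assume "x \<in> a"
    have "r ^ crowding (a - {x}) \<le> r ^ (crowding a + 5)"
      using assms by (intro power_increasing crowding_delete_le) auto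
    then show "r ^ crowding (a - {x}) \<le> r ^ crowding a + r ^ (crowding a + 5)"
      using assms by (simp add: add_increasing)
    assume "x \<notin> exposed a"
    then show "r ^ crowding (a - {x}) \<le> r ^ crowding a"
      using assms \<open>x \<in> a\<close> by (intro power_increasing delete_unexposed) auto
  qed (use assms in auto)
  also have "\<dots> = r ^ crowding a * (1 + 4 * r ^ 5 * card (inner_boundary a) / card a)"
    by (simp add: algebra_simps power_add)
  finally show ?thesis .
qed

text \<open>
  All sites except the two endpoints are interior, and at least three sites are occupied.
\<close>

lemma delete_site_interior_ge:
  assumes "finite a" "card a \<ge> 3"
    and "\<And>x. x \<in> a \<Longrightarrow> \<exists>w\<in>a. w < x \<Longrightarrow> \<exists>w\<in>a. x < w \<Longrightarrow> P (a - {x})"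
  shows "measure_pmf.expectation (delete_site a) (\<lambda>b. of_bool (P b)) \<ge> (1 / 3 :: real)"
proof -
  have ne: "a \<noteq> {}" using assms by auto
  have mm: "Min a \<in> a" "Max a \<in> a" using assms ne by auto
  have "card (a - {Min a, Max a}) \<ge> card a - 2"
    using diff_card_le_card_Diff[of "{Min a, Max a}" a] by (auto simp: card_insert_if split: if_splits)
  then have c: "real (card (a - {Min a, Max a})) \<ge> real (card a) - 2" by linarith
  have "real (card (a - {Min a, Max a})) = (\<Sum>x\<in>a - {Min a, Max a}. 1)" by simp
  also have "\<dots> \<le> (\<Sum>x\<in>a - {Min a, Max a}. of_bool (P (a - {x})))"
  proof (intro sum_mono)
    fix x assume x: "x \<in> a - {Min a, Max a}"
    then have "Min a < x" "x < Max a" using assms(1) by (auto simp: order_less_le)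
    then have "P (a - {x})" using assms(3)[of x] x mm by blast
    then show "1 \<le> (of_bool (P (a - {x})) :: real)" by simp
  qed
  also have "\<dots> \<le> (\<Sum>x\<in>a. of_bool (P (a - {x})))" using assms(1) by (intro sum_mono2) auto
  finally have "(\<Sum>x\<in>a. of_bool (P (a - {x}))) / card a \<ge> (real (card a) - 2) / card a"
    using c by (intro divide_right_mono) auto
  moreover have "(real (card a) - 2) / card a \<ge> 1 / 3" using assms(2) by (simp add: field_simps)
  ultimately show ?thesis unfolding expectation_delete_site[OF assms(1) ne] by linarith
qed

text \<open>
  An addition fills at most one hole. If there is exactly one, two of the three boundary sites
  lie outside the hull.
\<close>

lemma add_site_keeps_hole:
  assumes "finite a" "a \<noteq> {}" "holes a \<noteq> {}"
  shows "measure_pmf.expectation (add_site a) (\<lambda>b. of_bool (holes b \<noteq> {})) \<ge> (2 / 3 :: real)"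
proof -
  let ?S = "{y \<in> site_boundary a. holes (insert y a) \<noteq> {}}"
  have E: "measure_pmf.expectation (add_site a) (\<lambda>b. of_bool (holes b \<noteq> {}) :: real)
      = card ?S / (card (inner_boundary a) + 2)"
    using assms by (simp add: expectation_add_site sum.inter_filter[symmetric] of_bool_def sum.If_cases Int_def)
  show ?thesis
  proof (cases "card (holes a) = 1")
    case True
    have sub: "inner_boundary a \<subseteq> site_boundary a" by (auto simp: inner_boundary_def)
    have "site_boundary a - inner_boundary a \<subseteq> ?S"
      using assms by (auto simp: holes_insert inner_boundary_def)
    then have "card (site_boundary a - inner_boundary a) \<le> card ?S" using assms by (intro card_mono) auto
    then have "2 \<le> card ?S" using sub assms by (simp add: card_Diff_subset card_site_boundary)
    moreover have "card (inner_boundary a) \<le> 1" using card_inner_boundary_le[OF assms(1)] True by simp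
    ultimately show ?thesis unfolding E by (simp add: field_simps)
  next
    case False
    have "holes (insert y a) \<noteq> {}" if "y \<in> site_boundary a" for y
    proof
      assume "holes (insert y a) = {}"
      then have "holes a \<subseteq> {y}" using that by (simp add: holes_insert)
      then have "holes a = {y}" using assms(3) by blast
      then show False using False by simp
    qed
    then have "?S = site_boundary a" by blast
    then show ?thesis unfolding E using assms by (simp add: card_site_boundary)
  qed
qed

lemma delete_site_widens:
  assumes "finite a" "card a \<ge> 3" "holes a \<noteq> {}"
  shows "measure_pmf.expectation (delete_site a) (\<lambda>b. of_bool (excess b \<ge> 1)) \<ge> (1 / card a :: real)"
proof -
  obtain x where x: "x \<in> a" "excess (a - {x}) \<ge> 1" using exists_widening_deletion[OF assms] by blast
  have "a \<noteq> {}" using assms by auto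
  have "1 = (of_bool (excess (a - {x}) \<ge> 1) :: real)" using x by simp
  also have "\<dots> \<le> (\<Sum>x\<in>a. of_bool (excess (a - {x}) \<ge> 1))"
    using assms x by (intro member_le_sum) auto
  finally show ?thesis using assms \<open>a \<noteq> {}\<close> by (simp add: expectation_delete_site divide_right_mono)
qed

section \<open>Iterated additions and deletions\<close>

definition adding :: "nat \<Rightarrow> int set pmf \<Rightarrow> int set pmf" where
  "adding j = (\<lambda>p. bind_pmf p add_site) ^^ j"

definition deleting :: "nat \<Rightarrow> int set pmf \<Rightarrow> int set pmf" where
  "deleting i = (\<lambda>p. bind_pmf p delete_site) ^^ i"

lemma adding_simps [simp]: "adding 0 p = p" "adding (Suc j) p = bind_pmf (adding j p) add_site"
  by (simp_all add: adding_def)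

lemma deleting_simps [simp]: "deleting 0 p = p" "deleting (Suc i) p = bind_pmf (deleting i p) delete_site"
  by (simp_all add: deleting_def)

lemma ac_transition_eq: "ac_transition K a = deleting (K - 1) (adding K (return_pmf a))"
  by (simp add: ac_transition_def adding_def deleting_def)

lemma adding_support:
  assumes "finite a" "a \<noteq> {}"
  shows "finite (set_pmf (adding j (return_pmf a))) \<and> (\<forall>b\<in>set_pmf (adding j (return_pmf a)).
    finite b \<and> card b = card a + j \<and> card (holes b) \<le> card (holes a) \<and> excess b \<le> excess a \<and>
    crowding b \<le> crowding a \<and> card (inner_boundary a) \<le> card (inner_boundary b) + j \<and>
    card (inner_boundary b) \<le> card (inner_boundary a) + 2 * j)"
proof (induction j)
  case 0 then show ?case using assms by simp
next
  case (Suc j)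
  let ?p = "adding j (return_pmf a)"
  have ne: "finite b \<and> b \<noteq> {}" if "b \<in> set_pmf ?p" for b
  proof -
    have "finite b" "card b > 0" using Suc that assms by (auto simp: card_gt_0_iff)
    then show ?thesis by auto
  qed
  have set: "set_pmf (adding (Suc j) (return_pmf a)) = (\<Union>b\<in>set_pmf ?p. (\<lambda>y. insert y b) ` site_boundary b)"
    unfolding adding_simps set_bind_pmf using ne by (intro SUP_cong refl set_add_site) auto
  have "finite (set_pmf (adding (Suc j) (return_pmf a)))" unfolding set using Suc ne by (intro finite_UN_I) auto
  moreover have "finite c \<and> card c = card a + Suc j \<and> card (holes c) \<le> card (holes a) \<and> excess c \<le> excess a \<and>
    crowding c \<le> crowding a \<and> card (inner_boundary a) \<le> card (inner_boundary c) + Suc j \<and>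
    card (inner_boundary c) \<le> card (inner_boundary a) + 2 * Suc j"
    if cp: "c \<in> set_pmf (adding (Suc j) (return_pmf a))" for c
  proof -
    obtain b y where b: "b \<in> set_pmf ?p" and y: "y \<in> site_boundary b" and c: "c = insert y b"
      using cp unfolding set by blast
    have fb: "finite b" using ne b by blast
    have IH: "card b = card a + j" "card (holes b) \<le> card (holes a)" "excess b \<le> excess a"
      "crowding b \<le> crowding a" "card (inner_boundary a) \<le> card (inner_boundary b) + j"
      "card (inner_boundary b) \<le> card (inner_boundary a) + 2 * j" using Suc b by auto
    have "y \<notin> b" using y by (simp add: site_boundary_iff)
    then have "card c = card a + Suc j" using IH fb c by simp
    moreover have "card (holes c) \<le> card (holes b)" unfolding c holes_insert[OF y] using fb by (intro card_mono) auto
    moreover note excess_insert_le[OF fb y] crowding_insert_le[OF fb y] inner_boundary_insert_ge[OF fb y]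
      inner_boundary_insert_le[OF fb y]
    ultimately show ?thesis using IH fb unfolding c by auto
  qed
  ultimately show ?case by blast
qed

lemma deleting_support:
  assumes "finite a" "a \<noteq> {}" "i < card a + j"
  shows "finite (set_pmf (deleting i (adding j (return_pmf a)))) \<and>
    (\<forall>b\<in>set_pmf (deleting i (adding j (return_pmf a))).
    finite b \<and> card b = card a + j - i \<and> card (holes b) \<le> card (holes a) + i \<and>
    crowding b \<le> crowding a + 5 * i \<and> card (inner_boundary b) \<le> card (inner_boundary a) + 2 * j + i)"
  using assms(3)
proof (induction i)
  case 0 then show ?case using adding_support[OF assms(1,2), of j] by auto
next
  case (Suc i)
  let ?p = "deleting i (adding j (return_pmf a))"
  have ne: "finite b \<and> b \<noteq> {}" if "b \<in> set_pmf ?p" for b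
  proof -
    have "finite b" "card b > 0" using Suc that assms by (auto simp: card_gt_0_iff)
    then show ?thesis by auto
  qed
  have set: "set_pmf (deleting (Suc i) (adding j (return_pmf a))) = (\<Union>b\<in>set_pmf ?p. (\<lambda>x. b - {x}) ` b)"
    unfolding deleting_simps set_bind_pmf using ne by (intro SUP_cong refl set_delete_site) auto
  have "finite (set_pmf (deleting (Suc i) (adding j (return_pmf a))))"
    unfolding set using Suc ne by (intro finite_UN_I) auto
  moreover have "finite c \<and> card c = card a + j - Suc i \<and> card (holes c) \<le> card (holes a) + Suc i \<and>
    crowding c \<le> crowding a + 5 * Suc i \<and> card (inner_boundary c) \<le> card (inner_boundary a) + 2 * j + Suc i"
    if cp: "c \<in> set_pmf (deleting (Suc i) (adding j (return_pmf a)))" for c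
  proof -
    obtain b x where b: "b \<in> set_pmf ?p" and x: "x \<in> b" and c: "c = b - {x}"
      using cp unfolding set by blast
    have fb: "finite b" using ne b by blast
    have IH: "card b = card a + j - i" "card (holes b) \<le> card (holes a) + i"
      "crowding b \<le> crowding a + 5 * i"
      "card (inner_boundary b) \<le> card (inner_boundary a) + 2 * j + i" using Suc b by auto
    have "card c = card a + j - Suc i" using IH fb c x Suc.prems by simp
    moreover note card_holes_delete[OF fb, of x] crowding_delete_le[OF fb, of x] inner_boundary_delete[OF fb, of x]
    ultimately show ?thesis using IH fb unfolding c by auto
  qed
  ultimately show ?case by blast
qed

lemma finite_set_add_site: "finite a \<Longrightarrow> a \<noteq> {} \<Longrightarrow> finite (set_pmf (add_site a))"
  by (simp add: set_add_site)

lemma finite_set_delete_site: "finite a \<Longrightarrow> a \<noteq> {} \<Longrightarrow> finite (set_pmf (delete_site a))"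
  by (simp add: set_delete_site)

text \<open>
  Since \<open>f\<close> may be negative, the same lemma applied to \<open>- f\<close> gives lower bounds.
\<close>

lemma adding_le:
  fixes f :: "int set \<Rightarrow> real"
  assumes "finite a" "a \<noteq> {}" "c \<ge> 0"
    and "\<And>b i. i < j \<Longrightarrow> b \<in> set_pmf (adding i (return_pmf a)) \<Longrightarrow> finite b \<Longrightarrow> b \<noteq> {} \<Longrightarrow>
      measure_pmf.expectation (add_site b) f \<le> c * f b"
  shows "measure_pmf.expectation (adding j (return_pmf a)) f \<le> c ^ j * f a"
  using assms(4)
proof (induction j)
  case 0 then show ?case by simp
next
  case (Suc j)
  have ne: "finite b \<and> b \<noteq> {}" if "b \<in> set_pmf (adding j (return_pmf a))" for b
  proof -
    have "finite b" "card b = card a + j" "card a > 0"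
      using adding_support[OF assms(1,2), of j] that assms(1,2) by (auto simp: card_gt_0_iff)
    then show ?thesis by auto
  qed
  have "measure_pmf.expectation (adding (Suc j) (return_pmf a)) f
      \<le> measure_pmf.expectation (adding j (return_pmf a)) (\<lambda>b. c * f b)"
    unfolding adding_simps using Suc.prems ne adding_support[OF assms(1,2), of j]
    by (intro expectation_bind_le) (auto simp: finite_set_add_site)
  also have "\<dots> = c * measure_pmf.expectation (adding j (return_pmf a)) f" by simp
  also have "\<dots> \<le> c * (c ^ j * f a)"
  proof (intro mult_left_mono assms(3) Suc.IH)
    fix b i assume "i < j" "b \<in> set_pmf (adding i (return_pmf a))" "finite b" "b \<noteq> {}"
    then show "measure_pmf.expectation (add_site b) f \<le> c * f b" by (intro Suc.prems) auto
  qed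
  finally show ?case by simp
qed

lemma deleting_le:
  fixes f :: "int set \<Rightarrow> real"
  assumes "finite a" "a \<noteq> {}" "i \<le> card a + j - 1" "c \<ge> 0"
    and "\<And>b k. k < i \<Longrightarrow> b \<in> set_pmf (deleting k (adding j (return_pmf a))) \<Longrightarrow> finite b \<Longrightarrow> b \<noteq> {} \<Longrightarrow>
      measure_pmf.expectation (delete_site b) f \<le> c * f b + d"
  shows "measure_pmf.expectation (deleting i (adding j (return_pmf a))) f
    \<le> c ^ i * measure_pmf.expectation (adding j (return_pmf a)) f + d * (\<Sum>k<i. c ^ k)"
  using assms(3,5)
proof (induction i)
  case 0 then show ?case by simp
next
  case (Suc i)
  let ?p = "deleting i (adding j (return_pmf a))"
  have lt: "i < card a + j" using Suc.prems(1) assms(1,2) by (simp add: card_gt_0_iff Suc_le_eq)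
  have fin: "finite (set_pmf ?p)" using deleting_support[OF assms(1,2) lt] by blast
  have ne: "finite b \<and> b \<noteq> {}" if "b \<in> set_pmf ?p" for b
  proof -
    have "finite b" "card b = card a + j - i" using deleting_support[OF assms(1,2) lt] that by auto
    then show ?thesis using lt by auto
  qed
  have "measure_pmf.expectation (deleting (Suc i) (adding j (return_pmf a))) f
      \<le> measure_pmf.expectation ?p (\<lambda>b. c * f b + d)"
    unfolding deleting_simps using Suc.prems ne fin
    by (intro expectation_bind_le) (auto simp: finite_set_delete_site)
  also have "\<dots> = c * measure_pmf.expectation ?p f + d"
    using fin by (simp add: integrable_measure_pmf_finite)
  also have "\<dots> \<le> c * (c ^ i * measure_pmf.expectation (adding j (return_pmf a)) f + d * (\<Sum>k<i. c ^ k)) + d"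
  proof (intro add_mono mult_left_mono assms(4) Suc.IH order_refl)
    show "i \<le> card a + j - 1" using Suc.prems(1) by simp
    fix b k assume "k < i" "b \<in> set_pmf (deleting k (adding j (return_pmf a)))" "finite b" "b \<noteq> {}"
    then show "measure_pmf.expectation (delete_site b) f \<le> c * f b + d" by (intro Suc.prems(2)) auto
  qed
  also have "\<dots> = c ^ Suc i * measure_pmf.expectation (adding j (return_pmf a)) f + d * (\<Sum>k<Suc i. c ^ k)"
    by (subst sum.lessThan_Suc_shift) (simp add: algebra_simps sum_distrib_left)
  finally show ?case .
qed

section \<open>The drift of one step of the chain\<close>

lemma transition_support:
  assumes "finite a" "a \<noteq> {}" "K \<ge> 1"
  shows "finite (set_pmf (ac_transition K a))"
    and "\<And>b. b \<in> set_pmf (ac_transition K a) \<Longrightarrow> finite b \<and> card b = card a + 1 \<and>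
      card (holes b) \<le> card (holes a) + K \<and> crowding b \<le> crowding a + 5 * K"
proof -
  have "K - 1 < card a + K" using assms by auto
  note d = deleting_support[OF assms(1,2) this]
  show "finite (set_pmf (ac_transition K a))" using d by (simp add: ac_transition_eq)
  show "finite b \<and> card b = card a + 1 \<and>
      card (holes b) \<le> card (holes a) + K \<and> crowding b \<le> crowding a + 5 * K"
    if "b \<in> set_pmf (ac_transition K a)" for b
    using d that assms(3) unfolding ac_transition_eq by force
qed

lemma one_plus_inverse_power_le: "K \<ge> 1 \<Longrightarrow> (1 + 1 / real K) ^ K \<le> 3"
proof -
  assume K: "K \<ge> 1"
  have "(1 + 1 / real K) ^ K \<le> exp (1 / real K) ^ K" by (intro power_mono) auto
  also have "\<dots> = exp 1" using K by (simp add: exp_of_nat_mult[symmetric])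
  also have "\<dots> \<le> 3" by (rule exp_le)
  finally show ?thesis .
qed

lemma delete_site_power_holes_le:
  fixes s :: real
  assumes "finite a" "a \<noteq> {}" "s \<ge> 1"
  shows "measure_pmf.expectation (delete_site a) (\<lambda>b. s ^ card (holes b)) \<le> s * s ^ card (holes a)"
proof -
  have "s ^ card (holes (a - {x})) \<le> s * s ^ card (holes a)" for x
    using power_increasing[OF card_holes_delete[OF assms(1), of x] assms(3)] by simp
  then show ?thesis using delete_site_le[OF assms(1,2), of 0 "\<lambda>b. s ^ card (holes b)" "s * s ^ card (holes a)"] by simp
qed

text \<open>
  With a large inner boundary, \<open>K\<close> additions multiply the expectation of \<open>s ^ card (holes a)\<close> by
  about \<open>1 / s ^ K\<close>, and \<open>K - 1\<close> deletions by at most \<open>s ^ (K - 1)\<close>. The correction factor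
  \<open>(1 + 1 / K) ^ K\<close> is at most \<open>3\<close>, which a base \<open>s \<ge> 4\<close> outweighs.
\<close>

lemma transition_power_holes_le:
  fixes s :: real
  assumes "finite a" "a \<noteq> {}" "K \<ge> 1" "s \<ge> 4" and large: "K + 2 * K * s \<le> card (inner_boundary a)"
  shows "measure_pmf.expectation (ac_transition K a) (\<lambda>b. s ^ card (holes b)) \<le> 3 / 4 * s ^ card (holes a)"
proof -
  let ?f = "\<lambda>b. s ^ card (holes b)"
  define c where "c = (1 / s) * (1 + 1 / K)"
  have c: "c \<ge> 0" using assms by (simp add: c_def)
  have "measure_pmf.expectation (adding K (return_pmf a)) ?f \<le> c ^ K * ?f a"
  proof (rule adding_le[OF assms(1,2) c])
    fix b i assume i: "i < K" "b \<in> set_pmf (adding i (return_pmf a))" "finite b" "b \<noteq> {}"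
    let ?\<beta> = "real (card (inner_boundary b))"
    have "card (inner_boundary a) \<le> card (inner_boundary b) + i" using adding_support[OF assms(1,2), of i] i by blast
    then have "real (card (inner_boundary a)) \<le> ?\<beta> + K" using i by linarith
    then have "2 * K * s \<le> ?\<beta>" using large by linarith
    then have "K * (2 * (s - 1)) \<le> ?\<beta> + 2" using assms by (simp add: algebra_simps)
    then have "2 * (s - 1) / (?\<beta> + 2) \<le> 1 / K" using assms by (simp add: field_simps)
    then have "(1 / s) * (1 + 2 * (s - 1) / (?\<beta> + 2)) \<le> c" unfolding c_def using assms by (intro mult_left_mono) auto
    then have "?f b * ((1 / s) * (1 + 2 * (s - 1) / (?\<beta> + 2))) \<le> ?f b * c" using assms by (intro mult_left_mono) auto
    moreover have "measure_pmf.expectation (add_site b) ?f \<le> ?f b * ((1 / s) * (1 + 2 * (s - 1) / (?\<beta> + 2)))"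
      by (rule add_site_power_holes_le[unfolded of_nat_add of_nat_numeral]) (use i assms in auto)
    ultimately show "measure_pmf.expectation (add_site b) ?f \<le> c * ?f b"
      unfolding mult.commute[of c] by (rule order_trans[rotated])
  qed
  moreover have "measure_pmf.expectation (deleting (K - 1) (adding K (return_pmf a))) ?f
      \<le> s ^ (K - 1) * measure_pmf.expectation (adding K (return_pmf a)) ?f + 0 * (\<Sum>k<K - 1. s ^ k)"
    using assms by (intro deleting_le) (auto intro: delete_site_power_holes_le)
  ultimately have "measure_pmf.expectation (ac_transition K a) ?f \<le> s ^ (K - 1) * (c ^ K * ?f a)"
    unfolding ac_transition_eq using assms by (auto intro: order_trans mult_left_mono)
  also have "\<dots> = (1 + 1 / K) ^ K / s * ?f a"
  proof -
    obtain m where "K = Suc m" using assms(3) by (cases K) auto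
    then show ?thesis using assms(4) by (simp add: c_def power_mult_distrib power_divide)
  qed
  also have "\<dots> \<le> 3 / 4 * ?f a"
    using one_plus_inverse_power_le[OF assms(3)] assms(4) by (intro mult_right_mono frac_le) auto
  finally show ?thesis .
qed

lemma add_site_power_crowding_mono:
  fixes r :: real
  assumes "finite a" "a \<noteq> {}" "r \<ge> 1"
  shows "measure_pmf.expectation (add_site a) (\<lambda>b. r ^ crowding b) \<le> r ^ crowding a"
proof -
  have "measure_pmf.expectation (add_site a) (\<lambda>b. r ^ crowding b)
      \<le> measure_pmf.expectation (add_site a) (\<lambda>b. r ^ crowding a)"
    using assms by (intro expectation_mono_pmf)
      (auto simp: finite_set_add_site set_add_site intro!: power_increasing crowding_insert_le)
  then show ?thesis by simp
qed

text \<open>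
  The first addition is responsible for the gain; the following ones do no harm.
\<close>

lemma adding_power_crowding_le:
  fixes r :: real
  assumes "finite a" "a \<noteq> {}" "r \<ge> 1"
  shows "measure_pmf.expectation (adding (Suc j) (return_pmf a)) (\<lambda>b. r ^ crowding b)
    \<le> measure_pmf.expectation (add_site a) (\<lambda>b. r ^ crowding b)"
proof (induction j)
  case 0 then show ?case by (simp add: bind_return_pmf)
next
  case (Suc j)
  let ?p = "adding (Suc j) (return_pmf a)"
  have ne: "finite b \<and> b \<noteq> {}" if "b \<in> set_pmf ?p" for b
  proof -
    have "finite b" "card b = card a + Suc j" using adding_support[OF assms(1,2), of "Suc j"] that by blast+
    then show ?thesis by auto
  qed
  have "measure_pmf.expectation (bind_pmf ?p add_site) (\<lambda>b. r ^ crowding b)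
      \<le> measure_pmf.expectation ?p (\<lambda>b. r ^ crowding b)"
    using adding_support[OF assms(1,2), of "Suc j"] ne assms(3)
    by (intro expectation_bind_le) (auto simp del: adding_simps simp: finite_set_add_site add_site_power_crowding_mono)
  then show ?case using Suc by (simp only: adding_simps)
qed

lemma transition_power_crowding_le:
  fixes r :: real
  assumes "finite a" "a \<noteq> {}" "K \<ge> 1" "r \<ge> 2" "crowding a \<ge> 1"
  shows "measure_pmf.expectation (ac_transition K a) (\<lambda>b. r ^ crowding b) \<le>
    (1 + 4 * r ^ 5 * (card (inner_boundary a) + 3 * K) / card a) ^ (K - 1)
      * (r ^ crowding a * (1 - 1 / (2 * (card (inner_boundary a) + 2))))"
proof -
  let ?f = "\<lambda>b. r ^ crowding b" and ?\<beta> = "card (inner_boundary a)"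
  define \<gamma> where "\<gamma> = 1 + 4 * r ^ 5 * (?\<beta> + 3 * K) / card a"
  have \<gamma>: "\<gamma> \<ge> 0" using assms by (simp add: \<gamma>_def)
  have cpos: "card a > 0" using assms by auto
  obtain m where m: "K = Suc m" using assms(3) by (cases K) auto
  have add: "measure_pmf.expectation (adding K (return_pmf a)) ?f \<le> ?f a * (1 - 1 / (2 * (?\<beta> + 2)))"
    unfolding m using assms
    by (intro order_trans[OF adding_power_crowding_le add_site_power_crowding_le]) auto
  have "measure_pmf.expectation (deleting (K - 1) (adding K (return_pmf a))) ?f
      \<le> \<gamma> ^ (K - 1) * measure_pmf.expectation (adding K (return_pmf a)) ?f + 0 * (\<Sum>k<K - 1. \<gamma> ^ k)"
  proof (rule deleting_le[OF assms(1,2) _ \<gamma>])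
    fix b k assume k: "k < K - 1" "b \<in> set_pmf (deleting k (adding K (return_pmf a)))" "finite b" "b \<noteq> {}"
    have "k < card a + K" using k by simp
    note sup = deleting_support[OF assms(1,2) this]
    have cb: "card b = card a + K - k" "card (inner_boundary b) \<le> ?\<beta> + 2 * K + k" using sup k by blast+
    have "4 * r ^ 5 * card (inner_boundary b) / card b \<le> 4 * r ^ 5 * (?\<beta> + 3 * K) / card a"
    proof (intro frac_le mult_left_mono)
      have "card (inner_boundary b) \<le> ?\<beta> + 3 * K" using cb k by linarith
      then show "real (card (inner_boundary b)) \<le> real (?\<beta> + 3 * K)" by (simp only: of_nat_le_iff)
      show "real (card a) \<le> real (card b)" using cb k by simp
    qed (use assms cpos in auto)
    then have "?f b * (1 + 4 * r ^ 5 * card (inner_boundary b) / card b) \<le> ?f b * \<gamma>"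
      unfolding \<gamma>_def using assms by (intro mult_left_mono) auto
    moreover have "measure_pmf.expectation (delete_site b) ?f \<le> ?f b * (1 + 4 * r ^ 5 * card (inner_boundary b) / card b)"
      using k assms by (intro delete_site_power_crowding_le) auto
    ultimately show "measure_pmf.expectation (delete_site b) ?f \<le> \<gamma> * ?f b + 0"
      unfolding mult.commute[of \<gamma>] add_0_right by (rule order_trans[rotated])
  qed auto
  also have "\<dots> \<le> \<gamma> ^ (K - 1) * (?f a * (1 - 1 / (2 * (?\<beta> + 2))))"
    using add \<gamma> by (simp add: mult_left_mono)
  finally show ?thesis by (simp add: ac_transition_eq \<gamma>_def)
qed

text \<open>
  The two summands contract in complementary regions. Let \<open>\<beta>\<close> be the size of the inner boundary.
  
  \<^item> If \<open>\<beta>\<close> is at least \<open>b1\<close>, the second summand contracts by \<open>transition_power_holes_le\<close>.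
  
  \<^item> If \<open>\<beta>\<close> is less than \<open>b1\<close> and the crowding is positive, the first summand contracts, because the
    crowding drops with probability bounded below. The second summand may grow, but it is at most a
    constant times \<open>r ^ crowding a\<close>. The constant \<open>M\<close> is chosen so large that this is absorbed.
  
  \<^item> The first summand contracts for positive crowding as long as \<open>\<beta>\<close> is below any fixed bound \<open>b2\<close>
    and the configuration is large enough to make accidents rare. If \<open>\<beta>\<close> is at least \<open>b2\<close>, it is
    so small in comparison with the second summand that even its maximal growth does not matter.
  
  The threshold \<open>b1\<close> does not depend on \<open>M\<close>, while \<open>b2\<close> does; the intermediate region, where both
  summands contract, removes the circularity. At crowding zero and \<open>\<beta> < b2\<close> everything is bounded.
\<close>

lemma lyapunov_drift:
  fixes r :: real
  assumes r: "r \<ge> 2" and K: "K \<ge> 1"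
  shows "\<exists>M>0. \<exists>\<delta>>0. \<exists>C\<ge>0. \<exists>N\<^sub>0. \<delta> < 1 \<and> (\<forall>a. finite a \<longrightarrow> a \<noteq> {} \<longrightarrow> N\<^sub>0 \<le> card a \<longrightarrow>
    measure_pmf.expectation (ac_transition K a) (\<lambda>b. M * r ^ crowding b + (r\<^sup>2) ^ card (holes b))
    \<le> (1 - \<delta>) * (M * r ^ crowding a + (r\<^sup>2) ^ card (holes a)) + (if crowding a = 0 then C else 0))"
proof -
  define s where "s = r\<^sup>2"
  have s: "s \<ge> 4" using power_mono[OF r, of 2] by (simp add: s_def)
  have s_pow: "s ^ n = r ^ (2 * n)" for n by (simp add: s_def power_mult)
  define b1 where "b1 = nat \<lceil>K + 2 * K * s\<rceil>"
  have b1: "K + 2 * K * s \<le> b1" unfolding b1_def by linarith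
  define C1 where "C1 = r ^ (2 * b1 + 2 * K)"
  define t1 where "t1 = 1 / (4 * (real b1 + 2))"
  define M where "M = 2 * C1 / t1"
  have t1: "t1 > 0" by (simp add: t1_def add_pos_nonneg)
  have C1: "C1 > 0" using r by (simp add: C1_def)
  have M: "M > 0" using t1 C1 by (simp add: M_def)
  obtain m0 where "8 * M * r ^ (5 * K) < r ^ m0" using real_arch_pow[of r "8 * M * r ^ (5 * K)"] r by auto
  \<comment> \<open>If the inner boundary has at least \<open>2 * m\<close> sites, the first summand, even after its maximal
    growth by \<open>r ^ (5 * K)\<close>, is at most an eighth of the second one.\<close>
  define m where "m = max m0 b1"
  have m: "8 * M * r ^ (5 * K) \<le> r ^ m"
  proof -
    have "r ^ m0 \<le> r ^ m" using r by (intro power_increasing) (auto simp: m_def)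
    then show ?thesis using \<open>8 * M * r ^ (5 * K) < r ^ m0\<close> by linarith
  qed
  define b2 where "b2 = 2 * m"
  have b12: "b1 \<le> b2" by (simp add: b2_def m_def)
  define t2 where "t2 = 1 / (4 * (real b2 + 2))"
  have t2: "t2 > 0" by (simp add: t2_def add_pos_nonneg)
  have t21: "t2 \<le> t1" unfolding t1_def t2_def using b12 by (intro frac_le) auto
  have t1le: "t1 \<le> 1 / 8" unfolding t1_def by (intro frac_le) auto
  \<comment> \<open>Below \<open>b1\<close> half of the contraction \<open>t1\<close> is spent on the growth of the second summand.\<close>
  define \<delta> where "\<delta> = t2 / 2"
  have \<delta>: "\<delta> > 0" "\<delta> < 1" "\<delta> \<le> 1 / 8" "\<delta> \<le> t1 / 2" "\<delta> \<le> t2" using t1le t21 t2 by (auto simp: \<delta>_def)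
  define C where "C = M * r ^ (5 * K) + s ^ (b2 + K)"
  have C: "C \<ge> 0" using M r s by (simp add: C_def)
  define c0 where "c0 = 4 * r ^ 5 * (b2 + 3 * K)"
  have "(\<lambda>n. (1 + c0 / real n) ^ (K - 1)) \<longlonglongrightarrow> (1 + 0) ^ (K - 1)"
    by (intro tendsto_intros lim_const_over_n)
  then have "\<forall>\<^sub>F n in sequentially. (1 + c0 / real n) ^ (K - 1) < 1 + t2"
    using t2 by (intro order_tendstoD) auto
  then obtain N0 where N0: "\<And>n. n \<ge> N0 \<Longrightarrow> (1 + c0 / real n) ^ (K - 1) < 1 + t2"
    by (auto simp: eventually_sequentially)
  have "measure_pmf.expectation (ac_transition K a) (\<lambda>b. M * r ^ crowding b + s ^ card (holes b))
    \<le> (1 - \<delta>) * (M * r ^ crowding a + s ^ card (holes a)) + (if crowding a = 0 then C else 0)"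
    if a: "finite a" "a \<noteq> {}" "N0 \<le> card a" for a
  proof -
    let ?T = "ac_transition K a" and ?X = "crowding a" and ?L = "card (holes a)"
      and ?\<beta> = "card (inner_boundary a)"
    note sup = transition_support[OF a(1,2) K]
    have split: "measure_pmf.expectation ?T (\<lambda>b. M * r ^ crowding b + s ^ card (holes b))
      = M * measure_pmf.expectation ?T (\<lambda>b. r ^ crowding b) + measure_pmf.expectation ?T (\<lambda>b. s ^ card (holes b))"
      using sup(1) by (simp add: integrable_measure_pmf_finite)
    have Xle: "measure_pmf.expectation ?T (\<lambda>b. r ^ crowding b) \<le> r ^ (?X + 5 * K)"
    proof -
      have "measure_pmf.expectation ?T (\<lambda>b. r ^ crowding b) \<le> measure_pmf.expectation ?T (\<lambda>b. r ^ (?X + 5 * K))"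
        using sup r by (intro expectation_mono_pmf power_increasing) auto
      then show ?thesis by simp
    qed
    have Lle: "measure_pmf.expectation ?T (\<lambda>b. s ^ card (holes b)) \<le> s ^ (?L + K)"
    proof -
      have "measure_pmf.expectation ?T (\<lambda>b. s ^ card (holes b)) \<le> measure_pmf.expectation ?T (\<lambda>b. s ^ (?L + K))"
        using sup s by (intro expectation_mono_pmf power_increasing) auto
      then show ?thesis by simp
    qed
    have Lcon: "measure_pmf.expectation ?T (\<lambda>b. s ^ card (holes b)) \<le> 3 / 4 * s ^ ?L" if "?\<beta> \<ge> b1"
      using that b1 by (intro transition_power_holes_le a K s) linarith
    have Xcon: "measure_pmf.expectation ?T (\<lambda>b. r ^ crowding b) \<le> r ^ ?X * (1 - t)"
      if X: "?X \<ge> 1" and \<beta>: "?\<beta> < b2" and t: "t2 \<le> t" "2 * t \<le> 1 / (2 * (real ?\<beta> + 2))" for t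
    proof -
      define \<gamma> where "\<gamma> = (1 + 4 * r ^ 5 * (?\<beta> + 3 * K) / card a) ^ (K - 1)"
      have "\<gamma> \<le> (1 + c0 / card a) ^ (K - 1)" unfolding \<gamma>_def c0_def using r \<beta>
        by (intro power_mono add_left_mono divide_right_mono mult_left_mono) auto
      then have g: "\<gamma> \<le> 1 + t" using N0[OF a(3)] t(1) by linarith
      have "1 / (2 * (real ?\<beta> + 2)) \<le> 1 / 4" by (intro frac_le) auto
      then have pos: "1 - 1 / (2 * (real ?\<beta> + 2)) \<ge> 0" by linarith
      have "\<gamma> * (1 - 1 / (2 * (real ?\<beta> + 2))) \<le> (1 + t) * (1 - 2 * t)"
        using g pos t t2 by (intro mult_mono) auto
      also have "\<dots> \<le> 1 - t" by (simp add: algebra_simps)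
      finally have "r ^ ?X * (\<gamma> * (1 - 1 / (2 * (real ?\<beta> + 2)))) \<le> r ^ ?X * (1 - t)"
        using r by (intro mult_left_mono) auto
      moreover have "measure_pmf.expectation ?T (\<lambda>b. r ^ crowding b)
          \<le> \<gamma> * (r ^ ?X * (1 - 1 / (2 * (real ?\<beta> + 2))))"
        using transition_power_crowding_le[OF a(1,2) K r X]
        unfolding \<gamma>_def of_nat_add of_nat_mult of_nat_numeral .
      ultimately show ?thesis unfolding mult.left_commute[of \<gamma>] by linarith
    qed
    have rX: "r ^ ?X > 0" and sL: "s ^ ?L > 0" using r s by auto
    consider "b2 \<le> ?\<beta>" | "?\<beta> < b2" "?X = 0" | "?\<beta> < b1" "?X \<ge> 1" | "b1 \<le> ?\<beta>" "?\<beta> < b2" "?X \<ge> 1"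
      by linarith
    then show ?thesis
    proof cases
      case 1
      have "2 * ?X + 2 * m \<le> 4 * ?L" using crowding_le_holes[OF a(1)] 1 b2_def by linarith
      then have "r ^ (?X + m) \<le> s ^ ?L" unfolding s_pow using r by (intro power_increasing) auto
      moreover have "8 * M * r ^ (5 * K) * r ^ ?X \<le> r ^ m * r ^ ?X"
        using mult_right_mono[OF m, of "r ^ ?X"] rX by simp
      moreover have "r ^ (?X + m) = r ^ m * r ^ ?X" by (simp add: power_add)
      ultimately have "8 * M * r ^ (5 * K) * r ^ ?X \<le> s ^ ?L" by linarith
      moreover have "M * measure_pmf.expectation ?T (\<lambda>b. r ^ crowding b) \<le> M * (r ^ (5 * K) * r ^ ?X)"
        using Xle M by (simp add: power_add mult.commute)
      ultimately have "M * measure_pmf.expectation ?T (\<lambda>b. r ^ crowding b) \<le> s ^ ?L / 8" by simp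
      moreover have "measure_pmf.expectation ?T (\<lambda>b. s ^ card (holes b)) \<le> 3 / 4 * s ^ ?L"
        using Lcon b12 1 by simp
      moreover have "7 / 8 * s ^ ?L \<le> (1 - \<delta>) * s ^ ?L" using \<delta> sL by (intro mult_right_mono) auto
      moreover have "(1 - \<delta>) * (M * r ^ ?X) \<ge> 0" using \<delta> M rX by simp
      moreover have "(if ?X = 0 then C else 0) \<ge> 0" using C by simp
      ultimately show ?thesis unfolding split by (simp only: distrib_left)
    next
      case 2
      then have "?L < b2" using two_holes_le_crowding[OF a(1)] by linarith
      then have "s ^ (?L + K) \<le> s ^ (b2 + K)" using s by (intro power_increasing) auto
      then have "measure_pmf.expectation ?T (\<lambda>b. s ^ card (holes b)) \<le> s ^ (b2 + K)" using Lle by linarith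
      moreover have "M * measure_pmf.expectation ?T (\<lambda>b. r ^ crowding b) \<le> M * r ^ (5 * K)"
        using Xle M 2 by simp
      moreover have "(1 - \<delta>) * (M * r ^ ?X + s ^ ?L) \<ge> 0" using \<delta> M rX sL by simp
      ultimately show ?thesis unfolding split C_def using 2 by simp
    next
      case 3
      have "2 * ?L + 2 * K \<le> ?X + (2 * b1 + 2 * K)" using two_holes_le_crowding[OF a(1)] 3 by linarith
      then have "s ^ (?L + K) \<le> r ^ (?X + (2 * b1 + 2 * K))" unfolding s_pow using r by (intro power_increasing) auto
      then have L: "measure_pmf.expectation ?T (\<lambda>b. s ^ card (holes b)) \<le> r ^ ?X * C1"
        using Lle by (simp add: C1_def power_add)
      have "2 * t1 \<le> 1 / (2 * (real ?\<beta> + 2))" unfolding t1_def using 3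
        by (simp add: divide_simps)
      then have "measure_pmf.expectation ?T (\<lambda>b. r ^ crowding b) \<le> r ^ ?X * (1 - t1)"
        using Xcon[of t1] 3 b12 t21 by simp
      then have "M * measure_pmf.expectation ?T (\<lambda>b. r ^ crowding b) \<le> M * (r ^ ?X * (1 - t1))"
        using M by (intro mult_left_mono) auto
      also have "\<dots> = M * r ^ ?X - t1 * M * r ^ ?X" by (simp add: algebra_simps)
      finally have "M * measure_pmf.expectation ?T (\<lambda>b. r ^ crowding b) + measure_pmf.expectation ?T (\<lambda>b. s ^ card (holes b))
        \<le> M * r ^ ?X - t1 * M * r ^ ?X + r ^ ?X * C1" using L by linarith
      also have "C1 = t1 * M / 2" using t1 by (simp add: M_def)
      also have "M * r ^ ?X - t1 * M * r ^ ?X + r ^ ?X * (t1 * M / 2) = (1 - t1 / 2) * (M * r ^ ?X)"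
        by (simp add: algebra_simps)
      also have "\<dots> \<le> (1 - \<delta>) * (M * r ^ ?X)" using \<delta> M rX by (intro mult_right_mono) auto
      also have "\<dots> \<le> (1 - \<delta>) * (M * r ^ ?X + s ^ ?L)" using \<delta> sL by (intro mult_left_mono) auto
      finally show ?thesis unfolding split using 3 by simp
    next
      case 4
      have "2 * t2 \<le> 1 / (2 * (real ?\<beta> + 2))" unfolding t2_def using 4
        by (simp add: divide_simps)
      then have "measure_pmf.expectation ?T (\<lambda>b. r ^ crowding b) \<le> r ^ ?X * (1 - t2)"
        using Xcon[of t2] 4 by simp
      also have "\<dots> \<le> r ^ ?X * (1 - \<delta>)" using \<delta> rX by (intro mult_left_mono) auto
      finally have "M * measure_pmf.expectation ?T (\<lambda>b. r ^ crowding b) \<le> M * (r ^ ?X * (1 - \<delta>))"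
        using M by (intro mult_left_mono) auto
      moreover have "measure_pmf.expectation ?T (\<lambda>b. s ^ card (holes b)) \<le> 3 / 4 * s ^ ?L" using Lcon 4 by simp
      moreover have "3 / 4 * s ^ ?L \<le> (1 - \<delta>) * s ^ ?L" using \<delta> sL by (intro mult_right_mono) auto
      ultimately have "M * measure_pmf.expectation ?T (\<lambda>b. r ^ crowding b) + measure_pmf.expectation ?T (\<lambda>b. s ^ card (holes b))
        \<le> (1 - \<delta>) * (M * r ^ ?X + s ^ ?L)" by (simp add: algebra_simps)
      then show ?thesis unfolding split using 4 by simp
    qed
  qed
  then show ?thesis using M \<delta>(1,2) C unfolding s_def by blast
qed

lemma delete_site_crowded_le:
  assumes "finite a" "a \<noteq> {}"
  shows "measure_pmf.expectation (delete_site a) (\<lambda>b. of_bool (crowding b \<ge> 1))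
    \<le> of_bool (crowding a \<ge> 1) + 4 * card (inner_boundary a) / real (card a)"
proof -
  have "measure_pmf.expectation (delete_site a) (\<lambda>b. of_bool (crowding b \<ge> 1))
    \<le> of_bool (crowding a \<ge> 1) + 1 * (4 * card (inner_boundary a) / real (card a))"
  proof (rule delete_site_le[OF assms])
    fix x assume "x \<in> a" "x \<notin> exposed a"
    then have "crowding (a - {x}) \<le> crowding a" using assms delete_unexposed by blast
    then show "of_bool (crowding (a - {x}) \<ge> 1) \<le> (of_bool (crowding a \<ge> 1) :: real)" by auto
  qed auto
  then show ?thesis by simp
qed

text \<open>
  Two accidents are needed: at crowding zero, one deletion leaves the excess at most one.
\<close>

lemma delete_site_excess_ge2_le:
  assumes "finite a" "a \<noteq> {}"
  shows "measure_pmf.expectation (delete_site a) (\<lambda>b. of_bool (excess b \<ge> 2))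
    \<le> of_bool (excess a \<ge> 2) + of_bool (crowding a \<ge> 1) * (4 * card (inner_boundary a) / real (card a))"
proof (cases "crowding a = 0")
  case True
  have "measure_pmf.expectation (delete_site a) (\<lambda>b. of_bool (excess b \<ge> 2)) \<le> (0 :: real) + 0 * (4 * card (inner_boundary a) / card a)"
  proof (rule delete_site_le[OF assms])
    fix x assume "x \<in> a"
    have "excess (a - {x}) \<le> 1" using excess_delete_uncrowded assms True by blast
    then show "(of_bool (excess (a - {x}) \<ge> 2) :: real) \<le> 0" "(of_bool (excess (a - {x}) \<ge> 2) :: real) \<le> 0 + 0" by auto
  qed auto
  then show ?thesis by (simp add: add_nonneg_nonneg order_trans)
next
  case False
  have "measure_pmf.expectation (delete_site a) (\<lambda>b. of_bool (excess b \<ge> 2))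
    \<le> of_bool (excess a \<ge> 2) + 1 * (4 * card (inner_boundary a) / real (card a))"
  proof (rule delete_site_le[OF assms])
    fix x assume "x \<in> a" "x \<notin> exposed a"
    then have "excess (a - {x}) \<le> excess a" using assms delete_unexposed by blast
    then show "of_bool (excess (a - {x}) \<ge> 2) \<le> (of_bool (excess a \<ge> 2) :: real)" by auto
  qed auto
  then show ?thesis using False by simp
qed

text \<open>
  A bound for the probability of choosing an exposed site that is uniform over the deletions of one
  step.
\<close>

lemma error_rate_le:
  assumes "finite a" "a \<noteq> {}" "k < K" "b \<in> set_pmf (deleting k (adding K (return_pmf a)))"
  shows "4 * card (inner_boundary b) / real (card b) \<le> 4 * (card (holes a) + K) / real (card a)"
proof -
  have "k < card a + K" using assms(3) by simp
  note sup = deleting_support[OF assms(1,2) this]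
  have b: "finite b" "card b = card a + K - k" "card (holes b) \<le> card (holes a) + k" using sup assms(4) by blast+
  have "card (inner_boundary b) \<le> card (holes a) + K" using card_inner_boundary_le[OF b(1)] b(3) assms(3) by linarith
  moreover have "card a \<le> card b" "card a > 0" using b assms by auto
  ultimately show ?thesis by (intro frac_le) auto
qed

lemma deleting_crowded_le:
  assumes "finite a" "a \<noteq> {}" "i < K"
  shows "measure_pmf.expectation (deleting i (adding K (return_pmf a))) (\<lambda>b. of_bool (crowding b \<ge> 1))
    \<le> of_bool (crowding a \<ge> 1) + K * (4 * (card (holes a) + K) / real (card a))"
proof -
  let ?f = "\<lambda>b. of_bool (crowding b \<ge> 1) :: real" and ?d = "4 * (card (holes a) + K) / real (card a)"
  have "measure_pmf.expectation (deleting i (adding K (return_pmf a))) ?f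
      \<le> 1 ^ i * measure_pmf.expectation (adding K (return_pmf a)) ?f + ?d * (\<Sum>k<i. 1 ^ k)"
  proof (rule deleting_le[OF assms(1,2)])
    fix b k assume k: "k < i" "b \<in> set_pmf (deleting k (adding K (return_pmf a)))" "finite b" "b \<noteq> {}"
    then show "measure_pmf.expectation (delete_site b) ?f \<le> 1 * ?f b + ?d"
      using delete_site_crowded_le[OF k(3,4)] error_rate_le[OF assms(1,2) _ k(2)] assms(3) by simp
  qed (use assms in auto)
  moreover have "measure_pmf.expectation (adding K (return_pmf a)) ?f \<le> 1 ^ K * ?f a"
  proof (rule adding_le[OF assms(1,2)])
    fix b :: "int set" assume b: "finite b" "b \<noteq> {}"
    have "measure_pmf.expectation (add_site b) ?f \<le> measure_pmf.expectation (add_site b) (\<lambda>_. ?f b)"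
    proof (rule expectation_mono_pmf)
      fix c assume "c \<in> set_pmf (add_site b)"
      then obtain y where "y \<in> site_boundary b" "c = insert y b" using b set_add_site by blast
      then have "crowding c \<le> crowding b" using crowding_insert_le[OF b(1)] by simp
      then show "?f c \<le> ?f b" by auto
    qed (use b finite_set_add_site in auto)
    then show "measure_pmf.expectation (add_site b) ?f \<le> 1 * ?f b" by simp
  qed auto
  moreover have "?d * i \<le> ?d * K" using assms(3) by (intro mult_left_mono) auto
  ultimately show ?thesis by (simp add: mult.commute)
qed

lemma transition_crowded_le:
  assumes "finite a" "a \<noteq> {}" "K \<ge> 1"
  shows "measure_pmf.expectation (ac_transition K a) (\<lambda>b. of_bool (crowding b \<ge> 1))
    \<le> of_bool (crowding a \<ge> 1) + K * (4 * (card (holes a) + K) / real (card a))"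
  unfolding ac_transition_eq using assms by (intro deleting_crowded_le) auto

text \<open>
  Either the crowding is positive at the beginning, and one accident suffices, or two accidents
  occur within the step.
\<close>

lemma transition_excess_ge2_le:
  assumes "finite a" "a \<noteq> {}" "K \<ge> 1" "excess a \<le> 1"
  defines "e \<equiv> K * (4 * (card (holes a) + K) / real (card a))"
  shows "measure_pmf.expectation (ac_transition K a) (\<lambda>b. of_bool (excess b \<ge> 2))
    \<le> e * (of_bool (crowding a \<ge> 1) + e)"
proof -
  let ?f = "\<lambda>b. of_bool (excess b \<ge> 2) :: real" and ?g = "\<lambda>b. of_bool (crowding b \<ge> 1) :: real"
  let ?d = "4 * (card (holes a) + K) / real (card a)"
  have d: "?d \<ge> 0" by simp
  have "measure_pmf.expectation (deleting i (adding K (return_pmf a))) ?f \<le> i * (?d * (?g a + e))"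
    if "i < K" for i
    using that
  proof (induction i)
    case 0
    have "?f b = 0" if "b \<in> set_pmf (adding K (return_pmf a))" for b
      using adding_support[OF assms(1,2), of K] that assms(4) by fastforce
    then have "measure_pmf.expectation (adding K (return_pmf a)) ?f \<le> measure_pmf.expectation (adding K (return_pmf a)) (\<lambda>_. 0)"
      using adding_support[OF assms(1,2), of K] by (intro expectation_mono_pmf) auto
    then show ?case by simp
  next
    case (Suc i)
    let ?p = "deleting i (adding K (return_pmf a))"
    have lt: "i < card a + K" "i < K" using Suc.prems by auto
    note sup = deleting_support[OF assms(1,2) lt(1)]
    have ne: "finite b \<and> b \<noteq> {}" if "b \<in> set_pmf ?p" for b
    proof -
      have "finite b" "card b = card a + K - i" using sup that by blast+
      then show ?thesis using lt by auto
    qed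
    have fin: "finite (set_pmf ?p)" using sup by blast
    have "measure_pmf.expectation (deleting (Suc i) (adding K (return_pmf a))) ?f
      \<le> measure_pmf.expectation ?p (\<lambda>b. ?f b + ?g b * ?d)"
      unfolding deleting_simps
    proof (rule expectation_bind_le[OF fin])
      fix b assume b: "b \<in> set_pmf ?p"
      show "finite (set_pmf (delete_site b))" using ne b finite_set_delete_site by blast
      have "?g b * (4 * card (inner_boundary b) / real (card b)) \<le> ?g b * ?d"
        using error_rate_le[OF assms(1,2) lt(2) b] by (intro mult_left_mono) auto
      then show "measure_pmf.expectation (delete_site b) ?f \<le> ?f b + ?g b * ?d"
        using delete_site_excess_ge2_le[of b] ne b by fastforce
    qed
    also have "\<dots> = measure_pmf.expectation ?p ?f + measure_pmf.expectation ?p ?g * ?d"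
      using fin by (simp add: integrable_measure_pmf_finite)
    also have "\<dots> \<le> i * (?d * (?g a + e)) + (?g a + e) * ?d"
      using Suc.IH[OF lt(2)] deleting_crowded_le[OF assms(1,2) lt(2)] d unfolding e_def
      by (intro add_mono mult_right_mono) auto
    also have "\<dots> = Suc i * (?d * (?g a + e))" by (simp only: of_nat_Suc distrib_right mult_1 mult.commute add.commute)
    finally show ?case .
  qed
  from this[of "K - 1"] have "measure_pmf.expectation (ac_transition K a) ?f \<le> (K - 1) * (?d * (?g a + e))"
    unfolding ac_transition_eq using assms(3) by simp
  also have "\<dots> \<le> K * (?d * (?g a + e))" using d by (intro mult_right_mono) (auto simp: e_def)
  also have "\<dots> = e * (?g a + e)" unfolding e_def by (simp only: mult.assoc)
  finally show ?thesis .
qed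

section \<open>Creating a wide gap\<close>

text \<open>
  The last deletion makes a hole whenever it chooses an interior site.
\<close>

lemma transition_makes_hole:
  assumes "finite a" "a \<noteq> {}" "K \<ge> 2"
  shows "measure_pmf.expectation (ac_transition K a) (\<lambda>b. of_bool (holes b \<noteq> {})) \<ge> (1 / 3 :: real)"
proof -
  obtain m where m: "K - 1 = Suc m" using assms(3) by (cases "K - 1") auto
  let ?p = "deleting m (adding K (return_pmf a))"
  have lt: "m < card a + K" using m by simp
  note sup = deleting_support[OF assms(1,2) lt]
  have cpos: "card a > 0" using assms by auto
  have ne: "finite b \<and> card b \<ge> 3" if "b \<in> set_pmf ?p" for b
  proof -
    have "finite b" "card b = card a + K - m" using sup that by blast+
    then show ?thesis using m cpos by auto
  qed
  have "measure_pmf.expectation ?p (\<lambda>_. 1 / 3) \<le>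
    measure_pmf.expectation (bind_pmf ?p delete_site) (\<lambda>b. of_bool (holes b \<noteq> {}) :: real)"
  proof (rule expectation_bind_ge)
    fix b assume b: "b \<in> set_pmf ?p"
    have "b \<noteq> {}" using ne[OF b] by auto
    then show "finite (set_pmf (delete_site b))" using ne[OF b] finite_set_delete_site by blast
    show "1 / 3 \<le> measure_pmf.expectation (delete_site b) (\<lambda>b. of_bool (holes b \<noteq> {}) :: real)"
      using ne[OF b] by (intro delete_site_interior_ge) (auto simp: holes_delete_interior)
  qed (use sup in blast)
  then show ?thesis by (simp add: ac_transition_eq m del: One_nat_def)
qed

text \<open>
  Some hole is left after the additions and all deletions but the last, with probability bounded below,
  and the last deletion then widens a gap with probability at least one over the number of sites.
\<close>

lemma transition_widens:
  assumes "finite a" "a \<noteq> {}" "K \<ge> 2" "holes a \<noteq> {}"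
  shows "measure_pmf.expectation (ac_transition K a) (\<lambda>b. of_bool (excess b \<ge> 1))
    \<ge> (1 / 3) ^ (K - 2) * (2 / 3) ^ K / real (card a + 2)"
proof -
  let ?f = "\<lambda>b. - of_bool (holes b \<noteq> {}) :: real"
  obtain m where m: "K - 1 = Suc m" "K = m + 2" using assms(3) by (metis Suc_1 Suc_diff_1 add_2_eq_Suc' le_Suc_ex less_2_cases_iff not_less diff_Suc_1 plus_1_eq_Suc add.commute)
  let ?p = "deleting m (adding K (return_pmf a))"
  have lt: "m < card a + K" using m by simp
  note sup = deleting_support[OF assms(1,2) lt]
  have cpos: "card a > 0" using assms by auto
  have add: "measure_pmf.expectation (adding K (return_pmf a)) ?f \<le> (2 / 3) ^ K * ?f a"
  proof (rule adding_le[OF assms(1,2)])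
    fix b :: "int set" assume "finite b" "b \<noteq> {}"
    then show "measure_pmf.expectation (add_site b) ?f \<le> 2 / 3 * ?f b"
      using add_site_keeps_hole[of b] by (cases "holes b = {}") auto
  qed auto
  have "measure_pmf.expectation ?p ?f \<le> (1 / 3) ^ m * measure_pmf.expectation (adding K (return_pmf a)) ?f + 0 * (\<Sum>k<m. (1 / 3) ^ k)"
  proof (rule deleting_le[OF assms(1,2)])
    fix b k assume k: "k < m" "b \<in> set_pmf (deleting k (adding K (return_pmf a)))" "finite b" "b \<noteq> {}"
    have "k < card a + K" using k m by simp
    from deleting_support[OF assms(1,2) this] have "card b = card a + K - k" using k by blast
    then have "card b \<ge> 3" using k m cpos by simp
    then have "1 / 3 \<le> measure_pmf.expectation (delete_site b) (\<lambda>b. of_bool (holes b \<noteq> {}) :: real)"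
      using k by (intro delete_site_interior_ge) (auto simp: holes_delete_interior)
    moreover have "0 \<le> measure_pmf.expectation (delete_site b) (\<lambda>b. of_bool (holes b \<noteq> {}) :: real)"
      by simp
    ultimately show "measure_pmf.expectation (delete_site b) ?f \<le> 1 / 3 * ?f b + 0"
      by (cases "holes b = {}") auto
  qed (use m in auto)
  also have "\<dots> \<le> (1 / 3) ^ m * ((2 / 3) ^ K * ?f a)" using add by (simp del: of_bool_eq_1_iff)
  finally have p: "(1 / 3) ^ m * (2 / 3) ^ K \<le> measure_pmf.expectation ?p (\<lambda>b. of_bool (holes b \<noteq> {}) :: real)"
    using assms(4) by simp
  have "measure_pmf.expectation ?p (\<lambda>b. of_bool (holes b \<noteq> {}) / real (card a + 2)) \<le>
    measure_pmf.expectation (bind_pmf ?p delete_site) (\<lambda>b. of_bool (excess b \<ge> 1) :: real)"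
  proof (rule expectation_bind_ge)
    fix b assume b: "b \<in> set_pmf ?p"
    have fb: "finite b" "card b = card a + 2" using sup b m by auto
    then have "b \<noteq> {}" by auto
    then show "finite (set_pmf (delete_site b))" using fb finite_set_delete_site by blast
    show "of_bool (holes b \<noteq> {}) / real (card a + 2) \<le> measure_pmf.expectation (delete_site b) (\<lambda>b. of_bool (excess b \<ge> 1) :: real)"
    proof (cases "holes b = {}")
      case False
      then show ?thesis using delete_site_widens[of b] fb cpos by simp
    qed simp
  qed (use sup in blast)
  moreover have "(1 / 3) ^ m * (2 / 3) ^ K / real (card a + 2)
    \<le> measure_pmf.expectation ?p (\<lambda>b. of_bool (holes b \<noteq> {}) / real (card a + 2))"
    using p by (simp add: divide_right_mono)
  ultimately show ?thesis using m by (simp add: ac_transition_eq)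
qed

lemma two_transitions_widen:
  assumes "finite a" "a \<noteq> {}" "K \<ge> 2"
  shows "measure_pmf.expectation (bind_pmf (ac_transition K a) (ac_transition K)) (\<lambda>b. of_bool (excess b \<ge> 1))
    \<ge> (1 / 3) ^ (K - 1) * (2 / 3) ^ K / real (card a + 3)"
proof -
  let ?c = "(1 / 3) ^ (K - 2) * (2 / 3) ^ K / real (card a + 3)"
  have K1: "K \<ge> 1" using assms(3) by simp
  note sup = transition_support[OF assms(1,2) K1]
  have "measure_pmf.expectation (ac_transition K a) (\<lambda>b. of_bool (holes b \<noteq> {}) * ?c)
    \<le> measure_pmf.expectation (bind_pmf (ac_transition K a) (ac_transition K)) (\<lambda>b. of_bool (excess b \<ge> 1))"
  proof (rule expectation_bind_ge)
    fix b assume b: "b \<in> set_pmf (ac_transition K a)"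
    have fb: "finite b" "card b = card a + 1" using sup b by auto
    then have ne: "b \<noteq> {}" by auto
    show "finite (set_pmf (ac_transition K b))" using transition_support(1)[OF fb(1) ne K1] .
    show "of_bool (holes b \<noteq> {}) * ?c \<le> measure_pmf.expectation (ac_transition K b) (\<lambda>b. of_bool (excess b \<ge> 1))"
    proof (cases "holes b = {}")
      case False
      then show ?thesis using transition_widens[OF fb(1) ne assms(3) False] fb by (simp add: add.commute)
    qed simp
  qed (use sup in blast)
  moreover have "1 / 3 * ?c \<le> measure_pmf.expectation (ac_transition K a) (\<lambda>b. of_bool (holes b \<noteq> {}) * ?c)"
    using mult_right_mono[OF transition_makes_hole[OF assms], of ?c] by simp
  moreover have "(1 / 3 :: real) ^ (K - 1) = 1 / 3 * (1 / 3) ^ (K - 2)"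
    using assms(3) by (metis Suc_diff_Suc Suc_1 Suc_le_lessD power_Suc One_nat_def)
  then have "(1 / 3) ^ (K - 1) * (2 / 3) ^ K / real (card a + 3) = 1 / 3 * ?c"
    by (simp only: times_divide_eq_right mult.assoc)
  ultimately show ?thesis by linarith
qed

section \<open>The law of the path\<close>

text \<open>
  Every finite initial segment of the path has a law of finite support. Events of the process that
  depend on finitely many times are evaluated in this law.
\<close>

primrec path_law :: "nat \<Rightarrow> nat \<Rightarrow> int set list pmf" where
  "path_law K 0 = return_pmf [{0}]"
| "path_law K (Suc n) =
    bind_pmf (path_law K n) (\<lambda>xs. map_pmf (\<lambda>b. xs @ [b]) (ac_transition K (last xs)))"

lemma path_law_support:
  assumes "K \<ge> 1"
  shows "finite (set_pmf (path_law K n))"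
    and "xs \<in> set_pmf (path_law K n) \<Longrightarrow>
      length xs = Suc n \<and> finite (last xs) \<and> last xs \<noteq> {} \<and> card (last xs) = Suc n"
proof (induction n arbitrary: xs)
  case 0
  { case 1 then show ?case by simp }
  { case 2 then show ?case by simp }
next
  case (Suc n)
  have fin: "finite (last ys)" "last ys \<noteq> {}" if "ys \<in> set_pmf (path_law K n)" for ys using Suc(2)[OF that] by auto
  { case 1 then show ?case using Suc(1) transition_support(1)[OF fin assms] by auto }
  { case 2
    then obtain ys b where ys: "ys \<in> set_pmf (path_law K n)" "b \<in> set_pmf (ac_transition K (last ys))" "xs = ys @ [b]"
      by auto
    then have "finite b \<and> card b = card (last ys) + 1" using transition_support(2)[OF fin assms ys(2)] by blast
    moreover have "length ys = Suc n" "card (last ys) = Suc n" using Suc(2)[OF ys(1)] by auto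
    ultimately show ?case using ys(3) by auto }
qed

lemma expectation_path_law_Suc:
  fixes f :: "int set list \<Rightarrow> real"
  assumes "K \<ge> 1"
  shows "measure_pmf.expectation (path_law K (Suc n)) f =
    measure_pmf.expectation (path_law K n) (\<lambda>xs. measure_pmf.expectation (ac_transition K (last xs)) (\<lambda>b. f (xs @ [b])))"
proof -
  have "finite (set_pmf (ac_transition K (last xs)))" if "xs \<in> set_pmf (path_law K n)" for xs
    using path_law_support(2)[OF assms that] transition_support(1)[OF _ _ assms] by blast
  then show ?thesis using path_law_support(1)[OF assms] by (simp add: expectation_bind_pmf)
qed

lemma path_law_mono:
  fixes f g :: "int set list \<Rightarrow> real"
  assumes "K \<ge> 1" "\<And>xs. xs \<in> set_pmf (path_law K n) \<Longrightarrow> f xs \<le> g xs"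
  shows "measure_pmf.expectation (path_law K n) f \<le> measure_pmf.expectation (path_law K n) g"
  using assms path_law_support(1) by (intro expectation_mono_pmf) auto

lemma integrable_path_law:
  fixes f :: "int set list \<Rightarrow> real"
  shows "K \<ge> 1 \<Longrightarrow> integrable (measure_pmf (path_law K n)) f"
  by (simp add: integrable_measure_pmf_finite path_law_support(1))

lemma last_law_step_le:
  fixes f g :: "int set \<Rightarrow> real"
  assumes "K \<ge> 1"
    and "\<And>a. finite a \<Longrightarrow> a \<noteq> {} \<Longrightarrow> card a = Suc n \<Longrightarrow> measure_pmf.expectation (ac_transition K a) f \<le> g a"
  shows "measure_pmf.expectation (path_law K (Suc n)) (\<lambda>xs. f (last xs)) \<le> measure_pmf.expectation (path_law K n) (\<lambda>xs. g (last xs))"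
proof -
  have "measure_pmf.expectation (path_law K (Suc n)) (\<lambda>xs. f (last xs))
    = measure_pmf.expectation (path_law K n) (\<lambda>xs. measure_pmf.expectation (ac_transition K (last xs)) f)"
    using expectation_path_law_Suc[OF assms(1), of n "\<lambda>xs. f (last xs)"] by simp
  also have "\<dots> \<le> measure_pmf.expectation (path_law K n) (\<lambda>xs. g (last xs))"
    using assms path_law_support(2)[OF assms(1)] by (intro path_law_mono) auto
  finally show ?thesis .
qed

lemma expectation_of_bool:
  "measure_pmf.expectation p (\<lambda>x. of_bool (P x) :: real) = measure_pmf.prob p {x. P x}"
proof -
  have "(\<lambda>x. of_bool (P x) :: real) = indicator {x. P x}" by (auto simp: indicator_def)
  then show ?thesis by simp
qed

lemma pmf_snoc:
  "pmf (bind_pmf p (\<lambda>xs. map_pmf (\<lambda>b. xs @ [b]) (k xs))) (ys @ [c]) = pmf p ys * pmf (k ys) c"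
proof -
  have "pmf (map_pmf (\<lambda>b. xs @ [b]) (k xs)) (ys @ [c]) = indicator {ys} xs * pmf (k ys) c" for xs
  proof (cases "xs = ys")
    case True
    then show ?thesis using pmf_map_inj'[of "\<lambda>b. xs @ [b]" "k xs" c] by (simp add: inj_def)
  next
    case False
    then have "ys @ [c] \<notin> set_pmf (map_pmf (\<lambda>b. xs @ [b]) (k xs))" by auto
    then have "pmf (map_pmf (\<lambda>b. xs @ [b]) (k xs)) (ys @ [c]) = 0" by (simp only: set_pmf_iff not_not)
    then show ?thesis using False by (simp add: indicator_def)
  qed
  then have "pmf (bind_pmf p (\<lambda>xs. map_pmf (\<lambda>b. xs @ [b]) (k xs))) (ys @ [c])
    = measure_pmf.expectation p (\<lambda>xs. indicator {ys} xs * pmf (k ys) c)" by (simp add: pmf_bind)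
  also have "\<dots> = pmf p ys * pmf (k ys) c" by (simp add: measure_pmf_single)
  finally show ?thesis .
qed

context annihilation_creation_process
begin

definition history :: "nat \<Rightarrow> 'w \<Rightarrow> int set list" where
  "history n \<omega> = map (\<lambda>i. A i \<omega>) [0..<Suc n]"

lemma last_history [simp]: "last (history n \<omega>) = A n \<omega>"
  by (simp add: history_def)

lemma nth_history: "i \<le> n \<Longrightarrow> history n \<omega> ! i = A i \<omega>"
  unfolding history_def by (simp del: upt_Suc)

lemma state_event [measurable]: "Measurable.pred M (\<lambda>\<omega>. P (A n \<omega>))"
  by (rule measurable_compose[OF measurable_A]) simp

lemma state_finite: "\<omega> \<in> space M \<Longrightarrow> finite (A n \<omega>) \<and> A n \<omega> \<noteq> {}"
  using measurable_space[OF measurable_A, of \<omega> n] by simp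

lemma prob_path:
  assumes start: "AE \<omega> in M. A 0 \<omega> = {0}"
  shows "\<P>(\<omega> in M. \<forall>i\<le>n. A i \<omega> = a i) = pmf (path_law K n) (map a [0..<Suc n])"
proof (induction n)
  case 0
  have "\<P>(\<omega> in M. A 0 \<omega> = a 0) = \<P>(\<omega> in M. {0} = a 0)"
    using start by (intro prob_eq_AE) (auto elim: eventually_mono)
  then show ?case by (auto simp: indicator_def prob_space)
next
  case (Suc n)
  let ?P = "\<lambda>\<omega>. \<forall>i\<le>n. A i \<omega> = a i"
  have eq: "\<P>(\<omega> in M. \<forall>i\<le>Suc n. A i \<omega> = a i) = \<P>(\<omega> in M. A (Suc n) \<omega> = a (Suc n) \<and> ?P \<omega>)"
    by (intro arg_cong[where f = prob] Collect_cong) (auto simp: le_Suc_eq)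
  have "\<P>(\<omega> in M. A (Suc n) \<omega> = a (Suc n) \<and> ?P \<omega>) = \<P>(\<omega> in M. ?P \<omega>) * pmf (ac_transition K (a n)) (a (Suc n))"
  proof (cases "\<P>(\<omega> in M. ?P \<omega>) > 0")
    case True
    from markov[OF True, of "a (Suc n)"] True show ?thesis by (simp add: cond_prob_def field_simps)
  next
    case False
    then have z: "\<P>(\<omega> in M. ?P \<omega>) = 0" using measure_nonneg[of M] by (meson linorder_not_less order_antisym)
    have "\<P>(\<omega> in M. A (Suc n) \<omega> = a (Suc n) \<and> ?P \<omega>) \<le> \<P>(\<omega> in M. ?P \<omega>)"
      by (intro finite_measure_mono) auto
    then show ?thesis using z measure_nonneg[of M] by (simp add: order_antisym)
  qed
  also have "\<dots> = pmf (path_law K n) (map a [0..<Suc n]) * pmf (ac_transition K (last (map a [0..<Suc n]))) (a (Suc n))"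
    using Suc by simp
  also have "\<dots> = pmf (path_law K (Suc n)) (map a [0..<Suc n] @ [a (Suc n)])"
    by (simp only: path_law.simps pmf_snoc)
  finally show ?case unfolding eq by simp
qed

text \<open>
  The path law has total mass one on its finite support, so histories outside this support form a
  null set, and an event is the disjoint union of finitely many histories up to this null set.
\<close>

lemma prob_history:
  assumes start: "AE \<omega> in M. A 0 \<omega> = {0}" and K: "K \<ge> 1"
    and Q: "Measurable.pred M (\<lambda>\<omega>. Q (history n \<omega>))"
  shows "\<P>(\<omega> in M. Q (history n \<omega>)) = measure_pmf.prob (path_law K n) {xs. Q xs}"
proof -
  have hist: "history n \<omega> = xs \<longleftrightarrow> (\<forall>i\<le>n. A i \<omega> = xs ! i)" if "length xs = Suc n" for xs \<omega>
    unfolding history_def using that by (auto simp: list_eq_iff_nth_eq less_Suc_eq_le simp del: upt_Suc)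
  have single: "\<P>(\<omega> in M. history n \<omega> = xs) = pmf (path_law K n) xs" if "length xs = Suc n" for xs
  proof -
    have "map ((!) xs) [0..<Suc n] = xs" using that map_nth by metis
    then show ?thesis using prob_path[OF start, of n "\<lambda>i. xs ! i"] hist[OF that] by simp
  qed
  have meas: "{\<omega> \<in> space M. history n \<omega> = xs} \<in> sets M" if "length xs = Suc n" for xs
    unfolding hist[OF that] by measurable
  have sum: "\<P>(\<omega> in M. history n \<omega> \<in> S) = measure_pmf.prob (path_law K n) S
      \<and> {\<omega> \<in> space M. history n \<omega> \<in> S} \<in> sets M" if S: "S \<subseteq> set_pmf (path_law K n)" for S
  proof -
    have fin: "finite S" using S path_law_support(1)[OF K] finite_subset by blast
    have len: "length xs = Suc n" if "xs \<in> S" for xs using S path_law_support(2)[OF K] that by blast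
    have un: "{\<omega> \<in> space M. history n \<omega> \<in> S} = (\<Union>xs\<in>S. {\<omega> \<in> space M. history n \<omega> = xs})" by auto
    have "prob (\<Union>xs\<in>S. {\<omega> \<in> space M. history n \<omega> = xs}) = (\<Sum>xs\<in>S. \<P>(\<omega> in M. history n \<omega> = xs))"
      by (intro finite_measure_finite_Union fin) (auto simp: disjoint_family_on_def meas len)
    also have "\<dots> = (\<Sum>xs\<in>S. pmf (path_law K n) xs)" using len single by simp
    also have "\<dots> = measure_pmf.prob (path_law K n) S" using fin by (simp add: measure_measure_pmf_finite)
    finally show ?thesis unfolding un using meas len fin by (auto intro!: sets.finite_UN)
  qed
  let ?F = "set_pmf (path_law K n)"
  have "\<P>(\<omega> in M. history n \<omega> \<in> ?F) = 1" using sum[of ?F] by (simp add: measure_pmf_zero_iff measure_pmf.prob_eq_1 AE_measure_pmf)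
  then have ae: "AE \<omega> in M. history n \<omega> \<in> ?F" using sum[OF order_refl] prob_Collect_eq_1[of "\<lambda>\<omega>. history n \<omega> \<in> ?F"] by blast
  have "\<P>(\<omega> in M. Q (history n \<omega>)) = \<P>(\<omega> in M. history n \<omega> \<in> ?F \<inter> {xs. Q xs})"
    using ae sum[of "?F \<inter> {xs. Q xs}"] Q by (intro prob_eq_AE) (auto elim: eventually_mono)
  also have "\<dots> = measure_pmf.prob (path_law K n) {xs. Q xs}"
    using sum[of "?F \<inter> {xs. Q xs}"] by (simp add: measure_Int_set_pmf Int_commute)
  finally show ?thesis .
qed

end

lemma (in prob_space) AE_not_of_small:
  assumes S: "Measurable.pred M S" and le: "\<And>n. \<P>(\<omega> in M. S \<omega>) \<le> f n" and f: "f \<longlonglongrightarrow> 0"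
  shows "AE \<omega> in M. \<not> S \<omega>"
proof -
  have "\<P>(\<omega> in M. S \<omega>) \<le> 0" using f le by (intro LIMSEQ_le_const) auto
  then have "\<P>(\<omega> in M. S \<omega>) = 0" using measure_nonneg[of M] by (simp add: order_antisym)
  then show ?thesis using S prob_Collect_eq_0 by auto
qed

section \<open>Contracting recursions\<close>

lemma contraction_bounded:
  fixes x :: "nat \<Rightarrow> real"
  assumes "0 < \<delta>" "\<delta> < 1" and "\<And>n. n \<ge> n0 \<Longrightarrow> x (Suc n) \<le> (1 - \<delta>) * x n + C"
  obtains B where "\<And>n. x n \<le> B" "B \<ge> 0"
proof -
  define B where "B = Max (insert 0 (insert (C / \<delta>) (x ` {..n0})))"
  have B: "0 \<le> B" "C / \<delta> \<le> B" "\<And>n. n \<le> n0 \<Longrightarrow> x n \<le> B" unfolding B_def by (auto intro!: Max_ge simp del: Max_insert)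
  have "x n \<le> B" for n
  proof (induction n)
    case 0 then show ?case using B by simp
  next
    case (Suc n)
    show ?case
    proof (cases "Suc n \<le> n0")
      case False
      then have "x (Suc n) \<le> (1 - \<delta>) * x n + C" using assms by simp
      also have "\<dots> \<le> (1 - \<delta>) * B + \<delta> * B"
        using Suc B(2) assms by (intro add_mono mult_left_mono) (auto simp: field_simps)
      finally show ?thesis by (simp add: algebra_simps)
    qed (use B in simp)
  qed
  then show ?thesis using that B by blast
qed

text \<open>
  The product \<open>x n * (n + 1)\<close> satisfies a contracting recursion with bounded inhomogeneity, since
  the factor \<open>(n + 2) / (n + 1)\<close> is eventually at most \<open>1 + \<delta> / 2\<close>.
\<close>

lemma contraction_decay:
  fixes x :: "nat \<Rightarrow> real"
  assumes \<delta>: "0 < \<delta>" "\<delta> < 1" and C: "C \<ge> 0"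
    and step: "\<And>n. n \<ge> n0 \<Longrightarrow> x (Suc n) \<le> (1 - \<delta>) * x n + C / (real n + 1)"
  obtains B where "\<And>n. x n \<le> B / (real n + 1)" "B \<ge> 0"
proof -
  \<comment> \<open>Since \<open>x\<close> may be negative, the recursion is set up for the positive part of \<open>y\<close>.\<close>
  define y where "y n = x n * (real n + 1)" for n
  obtain n1 where n1: "n1 \<ge> n0" "2 / \<delta> \<le> real n1" by (meson le_cases nat_ceiling_le_eq order_refl order_trans real_nat_ceiling_ge of_nat_mono)
  have ystep: "y (Suc n) \<le> max ((1 - \<delta> / 2) * y n) 0 + 2 * C" if n: "n \<ge> n1" for n
  proof -
    define q where "q = (real n + 2) / (real n + 1)"
    have "2 / \<delta> \<le> real n + 1" using n n1 by simp
    then have "1 / (real n + 1) \<le> \<delta> / 2" using \<delta> by (simp add: field_simps)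
    moreover have "q = 1 + 1 / (real n + 1)" by (simp add: q_def field_simps)
    ultimately have q: "q \<le> 1 + \<delta> / 2" "q \<ge> 0" by auto
    have q2: "q \<le> 2" using q \<delta> by simp
    have "y (Suc n) = x (Suc n) * (real n + 2)" by (simp add: y_def)
    also have "\<dots> \<le> ((1 - \<delta>) * x n + C / (real n + 1)) * (real n + 2)"
      using step[of n] n n1 by (intro mult_right_mono) auto
    also have "\<dots> = (1 - \<delta>) * q * y n + q * C"
    proof -
      have "(u + C / t) * (q * t) = q * (u * t) + q * C" if "t > 0" for u t :: real
        using that by (simp add: field_simps)
      from this[of "real n + 1" "(1 - \<delta>) * x n"] show ?thesis
        by (simp add: q_def y_def mult_ac)
    qed
    also have "(1 - \<delta>) * q * y n \<le> max ((1 - \<delta> / 2) * y n) 0"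
    proof (cases "y n \<ge> 0")
      case True
      have "(1 - \<delta>) * q \<le> (1 - \<delta>) * (1 + \<delta> / 2)" using q \<delta> by (intro mult_left_mono) auto
      also have "\<dots> \<le> 1 - \<delta> / 2" using \<delta> by (simp add: algebra_simps)
      finally show ?thesis using True by (intro max.coboundedI1 mult_right_mono)
    next
      case False
      then have "(1 - \<delta>) * q * y n \<le> 0" using q \<delta> by (intro mult_nonneg_nonpos) auto
      then show ?thesis by simp
    qed
    also have "q * C \<le> 2 * C" using q2 C by (intro mult_right_mono) auto
    finally show ?thesis by simp
  qed
  have "max (y (Suc n)) 0 \<le> (1 - \<delta> / 2) * max (y n) 0 + 2 * C" if "n \<ge> n1" for n
  proof -
    have "max ((1 - \<delta> / 2) * y n) 0 = (1 - \<delta> / 2) * max (y n) 0" using \<delta> by (simp add: max_mult_distrib_left)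
    moreover have "(1 - \<delta> / 2) * max (y n) 0 \<ge> 0" using \<delta> by simp
    ultimately show ?thesis using ystep[OF that] C by simp
  qed
  then obtain B where B: "\<And>n. max (y n) 0 \<le> B" "B \<ge> 0"
    using contraction_bounded[of "\<delta> / 2" n1 "\<lambda>n. max (y n) 0" "2 * C"] \<delta> by auto
  have "x n \<le> B / (real n + 1)" for n
    using B(1)[of n] unfolding y_def by (simp add: field_simps)
  then show ?thesis using that B by blast
qed

text \<open>
  By \<open>1 - t \<le> exp (- t)\<close>, \<open>v j\<close> is at most \<open>v 0 * exp (- \<kappa> * harm j)\<close>, and the harmonic sums diverge.
\<close>

lemma harmonic_product_tendsto_0:
  fixes v :: "nat \<Rightarrow> real"
  assumes "\<kappa> > 0" "\<And>j. v j \<ge> 0" "\<And>j. v (Suc j) \<le> v j * (1 - \<kappa> / (real j + 1))"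
  shows "v \<longlonglongrightarrow> 0"
proof -
  have bound: "v j \<le> v 0 * exp (- \<kappa> * harm j)" for j
  proof (induction j)
    case 0 then show ?case by (simp add: harm_expand)
  next
    case (Suc j)
    have "v (Suc j) \<le> v j * exp (- \<kappa> / (real j + 1))"
      using assms(3)[of j] mult_left_mono[OF exp_ge_add_one_self[of "- \<kappa> / (real j + 1)"] assms(2)[of j]] by simp
    also have "\<dots> \<le> v 0 * exp (- \<kappa> * harm j) * exp (- \<kappa> / (real j + 1))" using Suc by (intro mult_right_mono) auto
    also have "\<dots> = v 0 * exp (- \<kappa> * harm (Suc j))"
      by (simp add: harm_Suc exp_add[symmetric] field_simps)
    finally show ?case .
  qed
  have lim: "(\<lambda>j. v 0 * exp (- \<kappa> * harm j)) \<longlonglongrightarrow> 0"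
  proof -
    have "filterlim (\<lambda>j. \<kappa> * harm j) at_top sequentially"
      using assms(1) harm_at_top by (intro filterlim_tendsto_pos_mult_at_top[OF tendsto_const]) auto
    then have "filterlim (\<lambda>j. - \<kappa> * harm j) at_bot sequentially" by (simp add: filterlim_uminus_at_top)
    then have "(\<lambda>j. exp (- \<kappa> * harm j)) \<longlonglongrightarrow> 0" by (rule filterlim_compose[OF exp_at_bot])
    then show ?thesis by (rule tendsto_mult_right_zero)
  qed
  show ?thesis
    by (rule tendsto_sandwich[OF always_eventually always_eventually tendsto_const lim])
      (use assms(2) bound in blast)+
qed

section \<open>Moments along the chain\<close>

text \<open>
  An upper bound for the probability that some deletion of the next step chooses an exposed site.
\<close>

definition error_rate :: "nat \<Rightarrow> int set \<Rightarrow> real" where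
  "error_rate K a = K * (4 * (card (holes a) + K) / real (card a))"

lemma error_rate_nonneg [simp]: "error_rate K a \<ge> 0"
  by (simp add: error_rate_def)

lemma error_rate_bound:
  assumes "K \<ge> 1"
  shows "error_rate K a \<le> 4 * (real K)\<^sup>2 * 4 ^ card (holes a) / card a"
proof -
  let ?L = "card (holes a)"
  have "?L + 1 \<le> 2 ^ ?L" by (simp add: Suc_le_eq)
  also have "(2 :: nat) ^ ?L \<le> 4 ^ ?L" by (intro power_mono) auto
  finally have "K * (?L + 1) \<le> K * 4 ^ ?L" by (rule mult_le_mono2)
  moreover have "?L + K \<le> K * (?L + 1)" using assms by simp
  ultimately have "?L + K \<le> K * 4 ^ ?L" by linarith
  then have "real (?L + K) \<le> real (K * 4 ^ ?L)" by (simp only: of_nat_le_iff)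
  then have "K * (4 * real (?L + K)) \<le> real K * (4 * real (K * 4 ^ ?L))" by (intro mult_left_mono) auto
  then have "K * (4 * real (?L + K)) / card a \<le> real K * (4 * real (K * 4 ^ ?L)) / card a" by (intro divide_right_mono) auto
  then show ?thesis by (simp add: error_rate_def power2_eq_square mult_ac)
qed

lemma error_rate_sq_bound:
  assumes "K \<ge> 1"
  shows "(error_rate K a)\<^sup>2 \<le> 16 * real K ^ 4 * 16 ^ card (holes a) / (real (card a))\<^sup>2"
proof -
  have "(error_rate K a)\<^sup>2 \<le> (4 * (real K)\<^sup>2 * 4 ^ card (holes a) / card a)\<^sup>2"
    using error_rate_bound[OF assms] by (intro power_mono) auto
  also have "\<dots> = 16 * real K ^ 4 * 16 ^ card (holes a) / (real (card a))\<^sup>2"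
  proof -
    have "((4 :: real) ^ card (holes a))\<^sup>2 = 16 ^ card (holes a)"
      by (simp add: power2_eq_square power_mult_distrib[symmetric])
    moreover have "((real K)\<^sup>2)\<^sup>2 = real K ^ 4" by (simp flip: power_mult)
    ultimately show ?thesis by (simp add: power_divide power_mult_distrib)
  qed
  finally show ?thesis .
qed

lemma holes_moment_bounded:
  assumes K: "K \<ge> 1"
  obtains B where "B \<ge> 0" "\<And>n. measure_pmf.expectation (path_law K n) (\<lambda>xs. 16 ^ card (holes (last xs)) :: real) \<le> B"
proof -
  obtain M \<delta> C N0 where M: "M > 0" and \<delta>: "\<delta> > 0" "\<delta> < 1" and C: "C \<ge> 0"
    and drift: "\<And>a. finite a \<Longrightarrow> a \<noteq> {} \<Longrightarrow> N0 \<le> card a \<Longrightarrow>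
      measure_pmf.expectation (ac_transition K a) (\<lambda>b. M * 4 ^ crowding b + (4\<^sup>2) ^ card (holes b))
      \<le> (1 - \<delta>) * (M * 4 ^ crowding a + (4\<^sup>2) ^ card (holes a)) + (if crowding a = 0 then C else (0 :: real))"
    using lyapunov_drift[of 4, OF _ K] by auto
  define \<Phi> where "\<Phi> b = M * 4 ^ crowding b + (4\<^sup>2) ^ card (holes b)" for b
  define x where "x n = measure_pmf.expectation (path_law K n) (\<lambda>xs. \<Phi> (last xs))" for n
  have "x (Suc n) \<le> (1 - \<delta>) * x n + C" if "n \<ge> N0" for n
  proof -
    have "x (Suc n) \<le> measure_pmf.expectation (path_law K n) (\<lambda>xs. (1 - \<delta>) * \<Phi> (last xs) + C)"
      unfolding x_def
    proof (rule last_law_step_le[OF K])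
      fix a :: "int set" assume "finite a" "a \<noteq> {}" "card a = Suc n"
      then show "measure_pmf.expectation (ac_transition K a) \<Phi> \<le> (1 - \<delta>) * \<Phi> a + C"
        using drift[of a] that C unfolding \<Phi>_def by (auto split: if_splits)
    qed
    also have "\<dots> = (1 - \<delta>) * x n + C" unfolding x_def using integrable_path_law[OF K] by simp
    finally show ?thesis .
  qed
  then obtain B where B: "\<And>n. x n \<le> B" "B \<ge> 0" using contraction_bounded[OF \<delta>] by blast
  have "measure_pmf.expectation (path_law K n) (\<lambda>xs. 16 ^ card (holes (last xs)) :: real) \<le> x n" for n
    unfolding x_def \<Phi>_def using M by (intro path_law_mono[OF K]) simp
  then show ?thesis using that B by (meson order_trans)
qed

text \<open>
  The Lyapunov function with \<open>r = 2\<close>, restricted to positive crowding, contracts where the crowding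
  is positive. From crowding zero it becomes positive only by an accident, of probability at most
  \<open>error_rate K a\<close>, and all factors are then bounded by a multiple of \<open>16 ^ card (holes a) / card a\<close>,
  whose expectation is \<open>O (1 / n)\<close> by the moment bound.
\<close>

lemma crowded_moment_decay:
  assumes K: "K \<ge> 1"
  obtains B where "B \<ge> 0" "\<And>n. measure_pmf.expectation (path_law K n)
    (\<lambda>xs. of_bool (crowding (last xs) \<ge> 1) * 4 ^ card (holes (last xs)) :: real) \<le> B / (real n + 1)"
proof -
  obtain M \<delta> C N0 where M: "M > 0" and \<delta>: "\<delta> > 0" "\<delta> < 1" and C: "C \<ge> 0"
    and drift: "\<And>a. finite a \<Longrightarrow> a \<noteq> {} \<Longrightarrow> N0 \<le> card a \<Longrightarrow>
      measure_pmf.expectation (ac_transition K a) (\<lambda>b. M * 2 ^ crowding b + (2\<^sup>2) ^ card (holes b))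
      \<le> (1 - \<delta>) * (M * 2 ^ crowding a + (2\<^sup>2) ^ card (holes a)) + (if crowding a = 0 then C else (0 :: real))"
    using lyapunov_drift[of 2, OF _ K] by auto
  obtain B0 where B0: "B0 \<ge> 0" "\<And>n. measure_pmf.expectation (path_law K n) (\<lambda>xs. 16 ^ card (holes (last xs)) :: real) \<le> B0"
    using holes_moment_bounded[OF K] by blast
  define \<Phi> where "\<Phi> b = M * 2 ^ crowding b + (2\<^sup>2) ^ card (holes b)" for b
  define F where "F b = of_bool (crowding b \<ge> 1) * \<Phi> b" for b
  define D where "D = (M * 2 ^ (5 * K) + 4 ^ K) * (4 * real K ^ 2)"
  have D: "D \<ge> 0" using M by (simp add: D_def)
  have \<Phi>pos: "\<Phi> b \<ge> 0" for b using M by (simp add: \<Phi>_def)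
  define x where "x n = measure_pmf.expectation (path_law K n) (\<lambda>xs. F (last xs))" for n
  have step: "measure_pmf.expectation (ac_transition K a) F \<le> (1 - \<delta>) * F a + D / (real n + 1) * 16 ^ card (holes a)"
    if a: "finite a" "a \<noteq> {}" "card a = Suc n" "n \<ge> N0" for a n
  proof (cases "crowding a = 0")
    case False
    have "measure_pmf.expectation (ac_transition K a) F \<le> measure_pmf.expectation (ac_transition K a) \<Phi>"
      using transition_support(1)[OF a(1,2) K] \<Phi>pos by (intro expectation_mono_pmf) (auto simp: F_def)
    also have "\<dots> \<le> (1 - \<delta>) * \<Phi> a" using drift[of a] a False unfolding \<Phi>_def by simp
    also have "\<dots> = (1 - \<delta>) * F a" using False by (simp add: F_def)
    also have "\<dots> \<le> (1 - \<delta>) * F a + D / (real n + 1) * 16 ^ card (holes a)" using D by simp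
    finally show ?thesis .
  next
    case True
    define G where "G = M * 2 ^ (5 * K) + 4 ^ (card (holes a) + K)"
    have G: "G \<ge> 0" using M by (simp add: G_def)
    have "measure_pmf.expectation (ac_transition K a) F \<le> measure_pmf.expectation (ac_transition K a) (\<lambda>b. of_bool (crowding b \<ge> 1) * G)"
    proof (rule expectation_mono_pmf[OF transition_support(1)[OF a(1,2) K]])
      fix b assume "b \<in> set_pmf (ac_transition K a)"
      then have "crowding b \<le> 5 * K" "card (holes b) \<le> card (holes a) + K"
        using transition_support(2)[OF a(1,2) K] True by auto
      then have "(2 :: real) ^ crowding b \<le> 2 ^ (5 * K)" "(4 :: real) ^ card (holes b) \<le> 4 ^ (card (holes a) + K)"
        by (auto intro!: power_increasing)
      then have "\<Phi> b \<le> G" using M by (simp add: \<Phi>_def G_def add_mono)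
      then show "F b \<le> of_bool (crowding b \<ge> 1) * G" by (simp add: F_def)
    qed
    also have "\<dots> = measure_pmf.expectation (ac_transition K a) (\<lambda>b. of_bool (crowding b \<ge> 1)) * G" by simp
    also have "\<dots> \<le> error_rate K a * G"
      using transition_crowded_le[OF a(1,2) K] True G by (intro mult_right_mono) (auto simp: error_rate_def)
    also have "\<dots> \<le> (4 * (real K)\<^sup>2 * 4 ^ card (holes a) / card a) * G"
      using error_rate_bound[OF K] G by (intro mult_right_mono)
    also have "\<dots> \<le> (4 * (real K)\<^sup>2 * 4 ^ card (holes a) / card a) * ((M * 2 ^ (5 * K) + 4 ^ K) * 4 ^ card (holes a))"
    proof (intro mult_left_mono)
      have "M * 2 ^ (5 * K) * 1 \<le> M * 2 ^ (5 * K) * 4 ^ card (holes a)" using M by (intro mult_left_mono one_le_power) auto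
      then show "G \<le> (M * 2 ^ (5 * K) + 4 ^ K) * 4 ^ card (holes a)" by (simp add: G_def power_add algebra_simps)
    qed auto
    also have "\<dots> = D / (real n + 1) * (4 ^ card (holes a) * 4 ^ card (holes a))"
      using a(3) by (simp add: D_def add.commute)
    also have "(4 :: real) ^ card (holes a) * 4 ^ card (holes a) = 16 ^ card (holes a)"
      by (simp add: power_mult_distrib[symmetric])
    also have "D / (real n + 1) * 16 ^ card (holes a) = (1 - \<delta>) * F a + D / (real n + 1) * 16 ^ card (holes a)"
      using True by (simp add: F_def)
    finally show ?thesis .
  qed
  have "x (Suc n) \<le> (1 - \<delta>) * x n + (D * B0) / (real n + 1)" if n: "n \<ge> N0" for n
  proof -
    have "x (Suc n) \<le> measure_pmf.expectation (path_law K n) (\<lambda>xs. (1 - \<delta>) * F (last xs) + D / (real n + 1) * 16 ^ card (holes (last xs)))"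
      unfolding x_def using step n by (intro last_law_step_le[OF K]) auto
    also have "\<dots> = (1 - \<delta>) * x n + D / (real n + 1) * measure_pmf.expectation (path_law K n) (\<lambda>xs. 16 ^ card (holes (last xs)))"
      unfolding x_def using integrable_path_law[OF K] by simp
    also have "\<dots> \<le> (1 - \<delta>) * x n + D / (real n + 1) * B0" using B0(2) D by (intro add_left_mono mult_left_mono) auto
    finally show ?thesis by simp
  qed
  then obtain B where B: "\<And>n. x n \<le> B / (real n + 1)" "B \<ge> 0"
    using contraction_decay[OF \<delta>, of "D * B0" N0 x] D B0(1) by auto
  have "measure_pmf.expectation (path_law K n)
    (\<lambda>xs. of_bool (crowding (last xs) \<ge> 1) * 4 ^ card (holes (last xs)) :: real) \<le> x n" for n
    unfolding x_def F_def \<Phi>_def using M by (intro path_law_mono[OF K] mult_left_mono) auto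
  then show ?thesis using that B by (meson order_trans)
qed

lemma excess_pos_prob_decay:
  assumes K: "K \<ge> 1"
  obtains B where "B \<ge> 0" "\<And>n. measure_pmf.prob (path_law K n) {xs. excess (last xs) \<ge> 1} \<le> B / (real n + 1)"
proof -
  obtain B where B: "B \<ge> 0" "\<And>n. measure_pmf.expectation (path_law K n)
    (\<lambda>xs. of_bool (crowding (last xs) \<ge> 1) * 4 ^ card (holes (last xs)) :: real) \<le> B / (real n + 1)"
    using crowded_moment_decay[OF K] by blast
  have "measure_pmf.prob (path_law K n) {xs. excess (last xs) \<ge> 1} \<le> measure_pmf.expectation (path_law K n)
    (\<lambda>xs. of_bool (crowding (last xs) \<ge> 1) * 4 ^ card (holes (last xs)) :: real)" for n
    unfolding expectation_of_bool[symmetric]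
    by (intro path_law_mono[OF K]) (auto simp: crowding_def)
  then show ?thesis using that B by (meson order_trans)
qed

text \<open>
  An accident is needed while the crowding is positive: both have probability of order \<open>1 / n\<close>,
  and the weight \<open>4 ^ card (holes a)\<close> in \<open>crowded_moment_decay\<close> pays for their dependence.
  Two accidents in the same step have conditional probability at most the square of the error rate.
\<close>

lemma entrance_prob_decay:
  assumes K: "K \<ge> 1"
  obtains B where "\<And>n. measure_pmf.prob (path_law K (Suc n)) {xs. excess (xs ! n) \<le> 1 \<and> excess (last xs) \<ge> 2}
    \<le> B / (real n + 1)\<^sup>2"
proof -
  obtain B1 where B1: "B1 \<ge> 0" "\<And>n. measure_pmf.expectation (path_law K n)
    (\<lambda>xs. of_bool (crowding (last xs) \<ge> 1) * 4 ^ card (holes (last xs)) :: real) \<le> B1 / (real n + 1)"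
    using crowded_moment_decay[OF K] by blast
  obtain B2 where B2: "B2 \<ge> 0" "\<And>n. measure_pmf.expectation (path_law K n) (\<lambda>xs. 16 ^ card (holes (last xs)) :: real) \<le> B2"
    using holes_moment_bounded[OF K] by blast
  let ?E = "\<lambda>n. measure_pmf.expectation (path_law K n)"
  have "measure_pmf.prob (path_law K (Suc n)) {xs. excess (xs ! n) \<le> 1 \<and> excess (last xs) \<ge> 2}
    \<le> (4 * (real K)\<^sup>2 * B1 + 16 * real K ^ 4 * B2) / (real n + 1)\<^sup>2" for n
  proof -
    let ?x = "\<lambda>a. of_bool (crowding a \<ge> 1) :: real" and ?L = "\<lambda>a. card (holes a)"
    have "measure_pmf.prob (path_law K (Suc n)) {xs. excess (xs ! n) \<le> 1 \<and> excess (last xs) \<ge> 2}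
      = ?E n (\<lambda>xs. measure_pmf.expectation (ac_transition K (last xs))
          (\<lambda>b. of_bool (excess ((xs @ [b]) ! n) \<le> 1 \<and> excess b \<ge> 2)))"
      unfolding expectation_of_bool[symmetric] expectation_path_law_Suc[OF K] by simp
    also have "\<dots> \<le> ?E n (\<lambda>xs. 4 * (real K)\<^sup>2 / (real n + 1) * (?x (last xs) * 4 ^ ?L (last xs))
        + 16 * real K ^ 4 / (real n + 1)\<^sup>2 * 16 ^ ?L (last xs))"
    proof (rule path_law_mono[OF K])
      fix xs assume "xs \<in> set_pmf (path_law K n)"
      then have xs: "length xs = Suc n" "finite (last xs)" "last xs \<noteq> {}" "card (last xs) = Suc n"
        using path_law_support(2)[OF K] by auto
      define a where "a = last xs"
      have a: "finite a" "a \<noteq> {}" "card a = Suc n" using xs by (auto simp: a_def)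
      have nth: "(xs @ [b]) ! n = a" for b
      proof -
        have "xs \<noteq> []" using xs(1) by auto
        then show ?thesis using xs(1) by (simp add: a_def nth_append last_conv_nth)
      qed
      let ?R = "4 * (real K)\<^sup>2 / (real n + 1) * (?x a * 4 ^ ?L a) + 16 * real K ^ 4 / (real n + 1)\<^sup>2 * 16 ^ ?L a"
      have R: "error_rate K a * (?x a + error_rate K a) \<le> ?R"
      proof -
        have n1: "real (card a) = real n + 1" using a by simp
        have "error_rate K a * ?x a \<le> (4 * (real K)\<^sup>2 * 4 ^ ?L a / card a) * ?x a"
          using error_rate_bound[OF K] by (intro mult_right_mono) auto
        moreover have "error_rate K a * error_rate K a \<le> 16 * real K ^ 4 * 16 ^ ?L a / (real (card a))\<^sup>2"
          using error_rate_sq_bound[OF K, of a] by (simp add: power2_eq_square)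
        ultimately show ?thesis unfolding n1 by (simp add: algebra_simps)
      qed
      show "measure_pmf.expectation (ac_transition K (last xs)) (\<lambda>b. of_bool (excess ((xs @ [b]) ! n) \<le> 1 \<and> excess b \<ge> 2))
        \<le> 4 * (real K)\<^sup>2 / (real n + 1) * (?x (last xs) * 4 ^ ?L (last xs))
        + 16 * real K ^ 4 / (real n + 1)\<^sup>2 * 16 ^ ?L (last xs)"
      proof (cases "excess a \<le> 1")
        case True
        then show ?thesis using transition_excess_ge2_le[OF a(1,2) K True] R
          unfolding nth a_def[symmetric] error_rate_def[symmetric] by simp
      next
        case False
        have "0 \<le> ?R" by simp
        with False show ?thesis unfolding nth a_def[symmetric] by simp
      qed
    qed
    also have "\<dots> = 4 * (real K)\<^sup>2 / (real n + 1) * ?E n (\<lambda>xs. ?x (last xs) * 4 ^ ?L (last xs))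
        + 16 * real K ^ 4 / (real n + 1)\<^sup>2 * ?E n (\<lambda>xs. 16 ^ ?L (last xs))"
      using integrable_path_law[OF K] by simp
    also have "\<dots> \<le> 4 * (real K)\<^sup>2 / (real n + 1) * (B1 / (real n + 1)) + 16 * real K ^ 4 / (real n + 1)\<^sup>2 * B2"
      by (intro add_mono mult_left_mono B1(2) B2(2)) auto
    also have "\<dots> = (4 * (real K)\<^sup>2 * B1 + 16 * real K ^ 4 * B2) / (real n + 1)\<^sup>2"
      by (simp add: power2_eq_square add_divide_distrib)
    finally show ?thesis .
  qed
  then show ?thesis using that by blast
qed

text \<open>
  Every second time is considered, since a configuration without holes may need one step to make
  a hole and another one to widen it.
\<close>

lemma no_excess_prob_tendsto_0:
  assumes K: "K \<ge> 2"
  shows "(\<lambda>j. measure_pmf.prob (path_law K (N + 2 * j)) {xs. \<forall>i\<le>j. excess (xs ! (N + 2 * i)) = 0}) \<longlonglongrightarrow> 0"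
proof -
  have K1: "K \<ge> 1" using K by simp
  define c :: real where "c = (1 / 3) ^ (K - 1) * (2 / 3) ^ K"
  have c: "c > 0" by (simp add: c_def)
  let ?H = "\<lambda>j xs. \<forall>i\<le>j. excess (xs ! (N + 2 * i)) = 0"
  let ?v = "\<lambda>j. measure_pmf.expectation (path_law K (N + 2 * j)) (\<lambda>xs. of_bool (?H j xs) :: real)"
  have "?v (Suc j) \<le> ?v j * (1 - c / (N + 4) / (real j + 1))" for j
  proof -
    let ?m = "N + 2 * j"
    have idx: "N + 2 * Suc j = Suc (Suc ?m)" by simp
    have "?v (Suc j) = measure_pmf.expectation (path_law K ?m) (\<lambda>xs. measure_pmf.expectation (ac_transition K (last xs))
      (\<lambda>b. measure_pmf.expectation (ac_transition K b) (\<lambda>b'. of_bool (?H (Suc j) ((xs @ [b]) @ [b'])))))"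
      unfolding idx expectation_path_law_Suc[OF K1] by simp
    also have "\<dots> \<le> measure_pmf.expectation (path_law K ?m) (\<lambda>xs. of_bool (?H j xs) * (1 - c / (N + 4) / (real j + 1)))"
    proof (rule path_law_mono[OF K1])
      fix xs assume "xs \<in> set_pmf (path_law K ?m)"
      then have xs: "length xs = Suc ?m" "finite (last xs)" "last xs \<noteq> {}" "card (last xs) = Suc ?m"
        using path_law_support(2)[OF K1] by auto
      define a where "a = last xs"
      note a = xs(2-4)[folded a_def]
      note sup = transition_support[OF a(1,2) K1]
      have fin2: "finite (set_pmf (ac_transition K b))" if "b \<in> set_pmf (ac_transition K a)" for b
      proof -
        have "finite b" "card b = card a + 1" using sup(2)[OF that] by auto
        then show ?thesis using transition_support(1)[OF _ _ K1, of b] by force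
      qed
      have H: "?H (Suc j) ((xs @ [b]) @ [b']) \<longleftrightarrow> ?H j xs \<and> \<not> excess b' \<ge> 1" for b b'
      proof -
        have "((xs @ [b]) @ [b']) ! (N + 2 * i) = xs ! (N + 2 * i)" if "i \<le> j" for i
          using that xs(1) by (simp add: nth_append)
        moreover have "((xs @ [b]) @ [b']) ! (N + 2 * Suc j) = b'" using xs(1) by (simp add: nth_append)
        ultimately show ?thesis by (auto simp: le_Suc_eq)
      qed
      have "measure_pmf.expectation (ac_transition K a) (\<lambda>b. measure_pmf.expectation (ac_transition K b)
          (\<lambda>b'. of_bool (?H (Suc j) ((xs @ [b]) @ [b']))))
        = of_bool (?H j xs) * measure_pmf.expectation (ac_transition K a) (\<lambda>b. measure_pmf.expectation (ac_transition K b)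
          (\<lambda>b'. of_bool (\<not> excess b' \<ge> 1) :: real))"
        unfolding H of_bool_conj by simp
      also have "measure_pmf.expectation (ac_transition K a) (\<lambda>b. measure_pmf.expectation (ac_transition K b)
          (\<lambda>b'. of_bool (\<not> excess b' \<ge> 1) :: real))
        = measure_pmf.expectation (bind_pmf (ac_transition K a) (ac_transition K)) (\<lambda>b'. 1 - of_bool (excess b' \<ge> 1))"
        using sup(1) fin2 by (subst expectation_bind_pmf) (auto simp: of_bool_not_iff)
      also have "\<dots> = 1 - measure_pmf.expectation (bind_pmf (ac_transition K a) (ac_transition K)) (\<lambda>b'. of_bool (excess b' \<ge> 1))"
        using sup(1) fin2 by (subst Bochner_Integration.integral_diff) (auto intro!: integrable_measure_pmf_finite)
      also have "\<dots> \<le> 1 - c / real (card a + 3)" using two_transitions_widen[OF a(1,2) K] by (simp add: c_def)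
      also have "\<dots> \<le> 1 - c / (N + 4) / (real j + 1)"
      proof -
        have "real (card a + 3) \<le> real (N + 4) * (real j + 1)" using a(3) by (simp add: algebra_simps)
        then have "c / (real (N + 4) * (real j + 1)) \<le> c / real (card a + 3)" using c by (intro divide_left_mono) auto
        then show ?thesis by simp
      qed
      finally show "measure_pmf.expectation (ac_transition K (last xs)) (\<lambda>b. measure_pmf.expectation (ac_transition K b)
          (\<lambda>b'. of_bool (?H (Suc j) ((xs @ [b]) @ [b'])))) \<le> of_bool (?H j xs) * (1 - c / (N + 4) / (real j + 1))"
        unfolding a_def[symmetric] by (simp add: mult_left_mono)
    qed
    also have "\<dots> = ?v j * (1 - c / (N + 4) / (real j + 1))" by simp
    finally show ?thesis .
  qed
  then have "?v \<longlonglongrightarrow> 0" using c by (intro harmonic_product_tendsto_0[of "c / (N + 4)"]) auto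
  then show ?thesis unfolding expectation_of_bool .
qed

section \<open>Almost sure behaviour of the gaps\<close>

theorem theorem2p1p2:
  fixes M :: "'w measure" and K :: nat and A :: "nat \<Rightarrow> 'w \<Rightarrow> int set"
  assumes "K \<ge> 2"
    and "annihilation_creation_process M K A"
    and "AE \<omega> in M. A 0 \<omega> = {0}"
  shows "AE \<omega> in M.
    infinite {n. num_gaps2 (A n \<omega>) = 1} \<and>
    infinite {n. num_gaps2 (A n \<omega>) = 0} \<and>
    (\<forall>\<^sub>F n in sequentially. num_unoccupied (A n \<omega>) \<le> num_gaps (A n \<omega>) + 1)"
proof -
  interpret annihilation_creation_process M K A by fact
  have K: "K \<ge> 1" using assms(1) by simp
  note start = assms(3)
  have "AE \<omega> in M. \<not> (\<forall>n\<ge>N. excess (A n \<omega>) \<ge> 1)" for N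
  proof -
    obtain B where B: "B \<ge> 0" "\<And>n. measure_pmf.prob (path_law K n) {xs. excess (last xs) \<ge> 1} \<le> B / (real n + 1)"
      using excess_pos_prob_decay[OF K] by blast
    have "(\<lambda>n. B / (real (N + n) + 1)) \<longlonglongrightarrow> 0"
      using LIMSEQ_ignore_initial_segment[OF lim_const_over_n[of B], of "N + 1"] by (simp add: add_ac)
    then show ?thesis
    proof (rule AE_not_of_small[rotated 2])
      fix n
      have "\<P>(\<omega> in M. \<forall>n\<ge>N. excess (A n \<omega>) \<ge> 1) \<le> \<P>(\<omega> in M. excess (A (N + n) \<omega>) \<ge> 1)"
        by (intro finite_measure_mono) auto
      also have "\<dots> = measure_pmf.prob (path_law K (N + n)) {xs. excess (last xs) \<ge> 1}"
        using prob_history[OF start K, of "\<lambda>xs. excess (last xs) \<ge> 1" "N + n"] by simp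
      finally show "\<P>(\<omega> in M. \<forall>n\<ge>N. excess (A n \<omega>) \<ge> 1) \<le> B / (real (N + n) + 1)" using B(2) order_trans by blast
    qed measurable
  qed
  then have ae0: "AE \<omega> in M. \<forall>N. \<exists>n\<ge>N. excess (A n \<omega>) = 0"
    by (simp add: AE_all_countable not_le)
  have "AE \<omega> in M. \<not> (\<forall>n\<ge>N. excess (A n \<omega>) = 0)" for N
  proof (rule AE_not_of_small)
    fix j
    have "\<P>(\<omega> in M. \<forall>n\<ge>N. excess (A n \<omega>) = 0) \<le> \<P>(\<omega> in M. \<forall>i\<le>j. excess (A (N + 2 * i) \<omega>) = 0)"
      by (intro finite_measure_mono) auto
    also have "\<dots> = \<P>(\<omega> in M. \<forall>i\<le>j. excess (history (N + 2 * j) \<omega> ! (N + 2 * i)) = 0)"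
      by (simp add: nth_history)
    also have "\<dots> = measure_pmf.prob (path_law K (N + 2 * j)) {xs. \<forall>i\<le>j. excess (xs ! (N + 2 * i)) = 0}"
      by (intro prob_history[OF start K]) (simp add: nth_history)
    finally show "\<P>(\<omega> in M. \<forall>n\<ge>N. excess (A n \<omega>) = 0)
      \<le> measure_pmf.prob (path_law K (N + 2 * j)) {xs. \<forall>i\<le>j. excess (xs ! (N + 2 * i)) = 0}" .
  qed (use no_excess_prob_tendsto_0[OF assms(1)] in measurable)
  then have ae1: "AE \<omega> in M. \<forall>N. \<exists>n\<ge>N. excess (A n \<omega>) \<ge> 1"
    by (simp add: AE_all_countable Suc_le_eq)
  have ae2: "AE \<omega> in M. \<forall>\<^sub>F n in sequentially. \<not> (excess (A n \<omega>) \<le> 1 \<and> excess (A (Suc n) \<omega>) \<ge> 2)"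
  proof -
    let ?S = "\<lambda>n. {\<omega> \<in> space M. excess (A n \<omega>) \<le> 1 \<and> excess (A (Suc n) \<omega>) \<ge> 2}"
    obtain B where B: "\<And>n. measure_pmf.prob (path_law K (Suc n)) {xs. excess (xs ! n) \<le> 1 \<and> excess (last xs) \<ge> 2}
      \<le> B / (real n + 1)\<^sup>2" using entrance_prob_decay[OF K] by blast
    have eq: "prob (?S n) = measure_pmf.prob (path_law K (Suc n)) {xs. excess (xs ! n) \<le> 1 \<and> excess (last xs) \<ge> 2}" for n
      using prob_history[OF start K, of "\<lambda>xs. excess (xs ! n) \<le> 1 \<and> excess (last xs) \<ge> 2" "Suc n"]
      by (simp add: nth_history)
    have "summable (\<lambda>n. 1 / (real (Suc n))\<^sup>2)"
      using inverse_power_summable[of 2, where 'a = real] by (subst summable_Suc_iff) (simp add: inverse_eq_divide power_one_over)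
    then have "summable (\<lambda>n. B * (1 / (real (Suc n))\<^sup>2))" by (rule summable_mult)
    then have "summable (\<lambda>n. prob (?S n))"
    proof (rule summable_comparison_test')
      show "norm (prob (?S n)) \<le> B * (1 / (real (Suc n))\<^sup>2)" if "n \<ge> 0" for n
        using B[of n] unfolding eq by (simp add: add.commute del: path_law.simps)
    qed
    then have "AE \<omega> in M. eventually (\<lambda>n. \<omega> \<in> space M - ?S n) sequentially"
      by (intro borel_cantelli_AE1) (auto simp: less_top[symmetric])
    then show ?thesis by (auto elim!: eventually_mono)
  qed
  show ?thesis using ae0 ae1 ae2 AE_space
  proof eventually_elim
    case (elim \<omega>)
    have fin: "finite (A n \<omega>)" "A n \<omega> \<noteq> {}" for n using state_finite elim(4) by auto
    obtain N0 where N0: "\<And>n. n \<ge> N0 \<Longrightarrow> \<not> (excess (A n \<omega>) \<le> 1 \<and> excess (A (Suc n) \<omega>) \<ge> 2)"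
      using elim(3) by (auto simp: eventually_sequentially)
    obtain N where N: "N \<ge> N0" "excess (A N \<omega>) = 0" using elim(1) by blast
    have le1: "excess (A n \<omega>) \<le> 1" if "n \<ge> N" for n
      using that
    proof (induction n rule: dec_induct)
      case base then show ?case using N by simp
    next
      case (step n) then show ?case using N0[of n] N by simp
    qed
    have "\<exists>n\<ge>k. num_gaps2 (A n \<omega>) = 1" for k
    proof -
      obtain n where n: "n \<ge> max k N" "excess (A n \<omega>) \<ge> 1" using elim(2) by blast
      then have "num_gaps2 (A n \<omega>) \<ge> 1" using num_gaps2_pos fin by blast
      moreover have "num_gaps2 (A n \<omega>) \<le> 1" using num_gaps2_le_excess[OF fin(1)] le1 n by (meson max.boundedE order_trans)
      ultimately show ?thesis using n by (intro exI[of _ n]) simp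
    qed
    moreover have "\<exists>n\<ge>k. num_gaps2 (A n \<omega>) = 0" for k
    proof -
      obtain n where n: "n \<ge> k" "excess (A n \<omega>) = 0" using elim(1) by blast
      then show ?thesis using num_gaps2_le_excess[OF fin(1), of n] by auto
    qed
    moreover have "\<forall>\<^sub>F n in sequentially. num_unoccupied (A n \<omega>) \<le> num_gaps (A n \<omega>) + 1"
      using eventually_ge_at_top[of N]
    proof eventually_elim
      case (elim n)
      then show ?case using num_unoccupied_le[OF fin, of n] le1[of n] by simp
    qed
    ultimately show ?case by (simp add: infinite_nat_iff_unbounded_le)
  qed
qed

end
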